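(* Let $0\le q<1$, $A,C\ge0$, $-1<B,D\le0$ be the parameters of open ASEP. Assume the high density phase $A>1$, $A>C$, and assume that $C/A\notin\{q^l:l\in\mathbb{Z}_+\}$ if $C\ge1$. Let $\lambda$ be the probability measure on $\{0,1\}^{\mathbb{Z}_+}$ whose marginal on $\{1,\dots,m\}$ is, for every $m\in\mathbb{Z}_+$, the probability measure $\lambda_m$ on $\{0,1\}^m$ determined by $$\mathbb{E}_{\lambda_m}\left[\prod_{i=1}^m t_i^{\tau_i}\right]=\frac{A^m}{(1+A)^{2m}}\int_{\mathbb{R}^m}\prod_{i=1}^m\left(1+t_i+2\sqrt{t_i}\,x_i\right)\pi^{(A,1/A,C,D)}_{t_1,\dots,t_m}(\mathrm{d}x_1,\dots,\mathrm{d}x_m)$$ for all $t_1\le\dots\le t_m$ in $(1-\varepsilon,1]$, for some $\varepsilon>0$ (such $\varepsilon$, $\lambda_m$ and $\lambda$ exist). Then $\lambda$ is a product Bernoulli measure (i.e. the occupation variables are i.i.d. Bernoulli of some density $\rho\in[0,1]$) if and only if $AC=1$, in which case it has density $A/(1+A)$.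
   Context: $\mathbb{Z}_+=\{1,2,\dots\}$, $\mathbb{N}_0=\{0,1,\dots\}$; $\tau_i\in\{0,1\}$ denotes the $i$-th coordinate (occupation variable). Open ASEP on $\{1,\dots,n\}$ has rates $\alpha,\beta>0$, $\gamma,\delta\ge0$, $0\le q<1$, and its parameters are $A=\phi_+(\beta,\delta)$, $B=\phi_-(\beta,\delta)$, $C=\phi_+(\alpha,\gamma)$, $D=\phi_-(\alpha,\gamma)$ with $\phi_\pm(x,y)=\frac{1}{2x}\left(1-q-x+y\pm\sqrt{(1-q-x+y)^2+4xy}\right)$; for fixed $q$ this is a bijection onto $A,C\ge0$, $-1<B,D\le0$. **Known fact (part of the setting).** Under the stated assumptions there exists $\varepsilon>0$ such that for all $m$ the right-hand side of the displayed formula is well defined and is the generating function of a unique probability measure $\lambda_m$, and these measures are consistent, so that $\lambda$ exists and is unique. **Askey--Wilson signed measures.** Write $(z)_n=\prod_{j=0}^{n-1}(1-zq^j)$ for $n\in\mathbb{N}_0\cup\{\infty\}$ and $(z_1,\dots,z_k)_n=\prod_i(z_i)_n$. Let $\Omega$ be the set of $(a,b,c,d)\in\mathbb{C}^4$ such that: (1) $a,b$ are real, $c,d$ are both real or form a complex conjugate pair, $ab<1$, $cd<1$; (2) for any two entries $\mathfrak{e},\mathfrak{f}$ in distinct positions of $(a,b,c,d)$ with $|\mathfrak{e}|,|\mathfrak{f}|\ge1$, $\mathfrak{e}/\mathfrak{f}\notin\{q^l:l\in\mathbb{Z}\}$ (for $q=0$: $\mathfrak e\neq q^l\mathfrak f$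 and $\mathfrak f\ne q^l\mathfrak e$ for $l\in\mathbb{N}_0$, $0^0=1$); (3) $q^labcd\ne1$ for all $l\in\mathbb{N}_0$. For $(a,b,c,d)\in\Omega$ the Askey--Wilson signed measure is the finite compactly supported signed measure on $\mathbb{R}$ (of total mass $1$) $$\nu(\mathrm{d}x;a,b,c,d)=f(x;a,b,c,d)\mathbf 1_{|x|<1}\mathrm{d}x+\sum_{x\in F(a,b,c,d)}p(x)\delta_x,$$ where for $x=\cos\vartheta\in(-1,1)$ $$f(x;a,b,c,d)=\frac{(q,ab,ac,ad,bc,bd,cd)_\infty}{2\pi(abcd)_\infty\sqrt{1-x^2}}\left|\frac{(e^{2\mathrm{i}\vartheta})_\infty}{(ae^{\mathrm{i}\vartheta},be^{\mathrm{i}\vartheta},ce^{\mathrm{i}\vartheta},de^{\mathrm{i}\vartheta})_\infty}\right|^2,$$ and the atoms $F(a,b,c,d)$ are generated by each entry of absolute value $\ge1$ (necessarily real): if $|a|\ge1$, then $a$ generates atoms $y_k^{\mathbf a}=\frac12\left(aq^k+(aq^k)^{-1}\right)$ for $k\ge0$ with $|aq^k|\ge1$, with masses $$p(y_0^{\mathbf a})=p_0^{\mathbf a}=\frac{(a^{-2},bc,bd,cd)_\infty}{(b/a,c/a,d/a,abcd)_\infty},\qquad p(y_k^{\mathbf a})=\frac{p_0^{\mathbf a}\,q^k(1-a^2q^{2k})(a^2,ab,ac,ad)_k}{(q)_k(1-a^2)a^k\prod_{l=1}^k\left((b-q^la)(c-q^la)(d-q^la)\right)}\ (k\ge1);$$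 atoms generated by $b,c,d$ and their masses are given by the same formulas with $a$ swapped with that parameter. For real $\mathsf A,\mathsf B,\mathsf C,\mathsf D$ and $t>0$ put $\pi_t^{(\mathsf A,\mathsf B,\mathsf C,\mathsf D)}(\mathrm{d}y)=\nu(\mathrm{d}y;\mathsf A\sqrt t,\mathsf B\sqrt t,\mathsf C/\sqrt t,\mathsf D/\sqrt t)$ with support $U_t$; for $s<t$ and $x\in U_s$ put $P_{s,t}^{(\mathsf A,\mathsf B)}(x,\mathrm{d}y)=\nu\left(\mathrm{d}y;\mathsf A\sqrt t,\mathsf B\sqrt t,\sqrt{\tfrac st}(x+\sqrt{x^2-1}),\sqrt{\tfrac st}(x-\sqrt{x^2-1})\right)$, and $P_{s,s}^{(\mathsf A,\mathsf B)}(x,\mathrm{d}y)=\delta_x(\mathrm{d}y)$. For $t_1\le\dots\le t_m$, $$\pi^{(\mathsf A,\mathsf B,\mathsf C,\mathsf D)}_{t_1,\dots,t_m}(\mathrm{d}x_1,\dots,\mathrm{d}x_m)=\pi_{t_1}^{(\mathsf A,\mathsf B,\mathsf C,\mathsf D)}(\mathrm{d}x_1)P^{(\mathsf A,\mathsf B)}_{t_1,t_2}(x_1,\mathrm{d}x_2)\cdots P^{(\mathsf A,\mathsf B)}_{t_{m-1},t_m}(x_{m-1},\mathrm{d}x_m).$$ It is used here with $(\mathsf A,\mathsf B,\mathsf C,\mathsf D)=(A,1/A,C,D)$. Convention at time $t=1$ (where the product of the first two parameters equals $1$, so the quadruple is not in $\Omega$): the formulas degenerate to a unit point mass, and one sets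 $\pi_1^{(A,1/A,C,D)}=\delta_{y_0}$ and $P_{s,1}^{(A,1/A)}(x,\cdot)=\delta_{y_0}$ for $s<1$, with $y_0=\frac12(A+A^{-1})$. *)

theory Defs
  imports "HOL-Probability.Probability"
begin

section \<open>Parameters of open ASEP\<close>

definition phi_plus :: "real \<Rightarrow> real \<Rightarrow> real \<Rightarrow> real" where
  "phi_plus q x y = (1 - q - x + y + sqrt ((1 - q - x + y)\<^sup>2 + 4 * x * y)) / (2 * x)"

definition phi_minus :: "real \<Rightarrow> real \<Rightarrow> real \<Rightarrow> real" where
  "phi_minus q x y = (1 - q - x + y - sqrt ((1 - q - x + y)\<^sup>2 + 4 * x * y)) / (2 * x)"

definition open_asep_parameters :: "real \<Rightarrow> real \<Rightarrow> real \<Rightarrow> real \<Rightarrow> real \<Rightarrow> bool" where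
  "open_asep_parameters q A B C D \<longleftrightarrow>
     (\<exists>\<alpha> \<beta> \<gamma> \<delta>. \<alpha> > 0 \<and> \<beta> > 0 \<and> \<gamma> \<ge> 0 \<and> \<delta> \<ge> 0 \<and>
        A = phi_plus q \<beta> \<delta> \<and> B = phi_minus q \<beta> \<delta> \<and>
        C = phi_plus q \<alpha> \<gamma> \<and> D = phi_minus q \<alpha> \<gamma>)"

lemma phi_surj:
  fixes q a b :: real
  assumes "q < 1" "0 \<le> a" "-1 < b" "b \<le> 0"
  shows "\<exists>x y. x > 0 \<and> y \<ge> 0 \<and> a = phi_plus q x y \<and> b = phi_minus q x y"
proof -
  define x where "x = (1 - q) / ((1 + a) * (1 + b))"
  define y where "y = - (a * b * x)"
  have x: "x > 0" using assms by (auto simp: x_def)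
  have "a * b \<le> 0" using assms by (simp add: mult_nonneg_nonpos)
  hence y: "y \<ge> 0" using x by (simp add: y_def mult_nonpos_nonneg)
  have "1 - q = x * ((1 + a) * (1 + b))" using assms by (simp add: x_def)
  hence lin: "1 - q - x + y = x * (a + b)" by (simp add: y_def algebra_simps)
  have "(x * (a + b))\<^sup>2 + 4 * x * y = (x * (a - b))\<^sup>2"
    by (simp add: y_def power2_eq_square algebra_simps)
  moreover have "0 \<le> x * (a - b)" using x assms by simp
  ultimately have root: "sqrt ((1 - q - x + y)\<^sup>2 + 4 * x * y) = x * (a - b)"
    by (simp add: lin)
  have "a = (x * (a + b) + x * (a - b)) / (2 * x)" "b = (x * (a + b) - x * (a - b)) / (2 * x)"
    using x by (simp_all add: field_simps)
  hence "a = phi_plus q x y" "b = phi_minus q x y"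
    unfolding phi_plus_def phi_minus_def root unfolding lin by simp_all
  with x y show ?thesis by blast
qed

lemma phi_range:
  fixes q x y :: real
  assumes "q < 1" "x > 0" "y \<ge> 0"
  shows "0 \<le> phi_plus q x y" "-1 < phi_minus q x y" "phi_minus q x y \<le> 0"
proof -
  define u where "u = 1 - q - x + y"
  define r where "r = sqrt (u\<^sup>2 + 4 * x * y)"
  have xy: "0 \<le> x * y" using assms by simp
  have "sqrt (u\<^sup>2) \<le> r" unfolding r_def using xy by (intro real_sqrt_le_mono) simp
  hence r: "\<bar>u\<bar> \<le> r" by simp
  have "0 < x * (1 - q)" using assms by simp
  hence "u\<^sup>2 + 4 * x * y < (u + 2 * x)\<^sup>2"
    by (simp add: u_def power2_eq_square algebra_simps)
  moreover have "0 < u + 2 * x" using assms by (simp add: u_def)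
  ultimately have r2: "r < u + 2 * x"
    unfolding r_def by (intro real_less_lsqrt) auto
  show "0 \<le> phi_plus q x y"
    using r assms by (simp add: phi_plus_def flip: u_def r_def)
  have "-1 < (u - r) / (2 * x)" using r2 assms by (simp add: field_simps)
  thus "-1 < phi_minus q x y" by (simp add: phi_minus_def u_def r_def)
  show "phi_minus q x y \<le> 0"
    using r assms by (simp add: phi_minus_def divide_nonpos_pos flip: u_def r_def)
qed

lemma open_asep_parameters_iff:
  assumes "q < 1"
  shows "open_asep_parameters q A B C D \<longleftrightarrow>
    0 \<le> A \<and> -1 < B \<and> B \<le> 0 \<and> 0 \<le> C \<and> -1 < D \<and> D \<le> 0"
  using phi_surj[OF assms, of A B] phi_surj[OF assms, of C D] phi_range[OF assms]
  unfolding open_asep_parameters_def by meson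


section \<open>Askey--Wilson signed measures\<close>

definition qpoch :: "real \<Rightarrow> complex list \<Rightarrow> nat \<Rightarrow> complex" where
  "qpoch q zs n = (\<Prod>z\<leftarrow>zs. \<Prod>j<n. 1 - z * of_real q ^ j)"

definition qpoch_inf :: "real \<Rightarrow> complex list \<Rightarrow> complex" where
  "qpoch_inf q zs = (\<Prod>z\<leftarrow>zs. prodinf (\<lambda>j. 1 - z * of_real q ^ j))"

text \<open>
  The set \<open>\<Omega>\<close>. Since \<open>(i, j)\<close> ranges over ordered pairs, excluding
  \<open>e = q^l f\<close> for \<open>l \<ge> 0\<close> in both orders excludes \<open>e / f = q^l\<close> for all integers
  \<open>l\<close> when \<open>q > 0\<close>, and is the condition required for \<open>q = 0\<close>.
\<close>
definition aw_Omega :: "real \<Rightarrow> (complex \<times> complex \<times> complex \<times> complex) set" where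
  "aw_Omega q = {(a, b, c, d).
     a \<in> \<real> \<and> b \<in> \<real> \<and> (c \<in> \<real> \<and> d \<in> \<real> \<or> d = cnj c) \<and> Re (a * b) < 1 \<and> Re (c * d) < 1 \<and>
     (\<forall>i<4. \<forall>j<4. i \<noteq> j \<longrightarrow>
        norm ([a, b, c, d] ! i) \<ge> 1 \<longrightarrow> norm ([a, b, c, d] ! j) \<ge> 1 \<longrightarrow>
        (\<forall>l::nat. [a, b, c, d] ! i \<noteq> of_real q ^ l * [a, b, c, d] ! j)) \<and>
     (\<forall>l::nat. of_real q ^ l * (a * b * c * d) \<noteq> 1)}"

text \<open>
  The parameters are complex because one pair may be complex conjugate; on \<open>\<Omega>\<close> the
  density and the masses are real, so that taking real parts only changes the type.
\<close>
definition aw_density :: "real \<Rightarrow> complex \<Rightarrow> complex \<Rightarrow> complex \<Rightarrow> complex \<Rightarrow> real \<Rightarrow> real" where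
  "aw_density q a b c d x =
     (let z = cis (arccos x) in
        Re (qpoch_inf q [of_real q, a * b, a * c, a * d, b * c, b * d, c * d]
            / qpoch_inf q [a * b * c * d])
        / (2 * pi * sqrt (1 - x\<^sup>2))
        * (norm (qpoch_inf q [z\<^sup>2] / qpoch_inf q [a * z, b * z, c * z, d * z]))\<^sup>2)"

definition aw_atom :: "real \<Rightarrow> complex \<Rightarrow> nat \<Rightarrow> real" where
  "aw_atom q a k = Re ((a * of_real q ^ k + inverse (a * of_real q ^ k)) / 2)"

definition aw_mass0 :: "real \<Rightarrow> complex \<Rightarrow> complex \<Rightarrow> complex \<Rightarrow> complex \<Rightarrow> complex" where
  "aw_mass0 q a b c d =
     qpoch_inf q [inverse (a\<^sup>2), b * c, b * d, c * d]
     / qpoch_inf q [b / a, c / a, d / a, a * b * c * d]"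

definition aw_mass :: "real \<Rightarrow> complex \<Rightarrow> complex \<Rightarrow> complex \<Rightarrow> complex \<Rightarrow> nat \<Rightarrow> real" where
  "aw_mass q a b c d k =
     (let Q = complex_of_real q in
      if k = 0 then Re (aw_mass0 q a b c d)
      else Re (aw_mass0 q a b c d * Q ^ k * (1 - a\<^sup>2 * Q ^ (2 * k))
                 * qpoch q [a\<^sup>2, a * b, a * c, a * d] k
               / (qpoch q [Q] k * (1 - a\<^sup>2) * a ^ k
                 * (\<Prod>l=1..k. (b - Q ^ l * a) * (c - Q ^ l * a) * (d - Q ^ l * a)))))"

text \<open>
  The library has no signed measures. A signed measure \<open>\<nu>\<close> on the real line is represented by
  its integration functional, mapping \<open>g\<close> to the integral of \<open>g\<close> against \<open>\<nu>\<close>.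
\<close>
type_synonym signed_integral = "(real \<Rightarrow> real) \<Rightarrow> real"

definition dirac :: "real \<Rightarrow> signed_integral" where
  "dirac y g = g y"

text \<open>
  The set of \<open>k\<close> below is empty if the generating entry has absolute value less than 1. On
  \<open>\<Omega>\<close> different pairs of a generating position and an index \<open>k\<close> give different
  atoms, so that the sum over such pairs is the sum over \<open>F(a,b,c,d)\<close>. Outside
  \<open>\<Omega>\<close> the signed measure is not defined; the functional is then set to 0.
\<close>
definition aw_measure ::
  "real \<Rightarrow> complex \<Rightarrow> complex \<Rightarrow> complex \<Rightarrow> complex \<Rightarrow> signed_integral" where
  "aw_measure q a b c d g =
     (if (a, b, c, d) \<in> aw_Omega q then
        (LBINT x:{-1<..<1}. aw_density q a b c d x * g x)
        + (\<Sum>(a', b', c', d') \<leftarrow> [(a, b, c, d), (b, a, c, d), (c, b, a, d), (d, b, c, a)].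
             \<Sum>k \<in> {k. 1 \<le> norm (a' * of_real q ^ k)}.
               aw_mass q a' b' c' d' k * g (aw_atom q a' k))
      else 0)"


section \<open>The multi-time signed measures\<close>

text \<open>
  If \<open>a * b = 1\<close> then at time 1 the quadruples are not in \<open>\<Omega>\<close>; the signed measures
  are then unit point masses by convention.
\<close>
definition aw_pi :: "real \<Rightarrow> real \<Rightarrow> real \<Rightarrow> real \<Rightarrow> real \<Rightarrow> real \<Rightarrow> signed_integral" where
  "aw_pi q a b c d t =
     (if a * b = 1 \<and> t = 1 then dirac ((a + 1 / a) / 2)
      else aw_measure q (of_real (a * sqrt t)) (of_real (b * sqrt t))
                        (of_real (c / sqrt t)) (of_real (d / sqrt t)))"

definition aw_P :: "real \<Rightarrow> real \<Rightarrow> real \<Rightarrow> real \<Rightarrow> real \<Rightarrow> real \<Rightarrow> signed_integral" where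
  "aw_P q a b s t x =
     (if s = t then dirac x
      else if a * b = 1 \<and> t = 1 then dirac ((a + 1 / a) / 2)
      else aw_measure q (of_real (a * sqrt t)) (of_real (b * sqrt t))
             (of_real (sqrt (s / t)) * (of_real x + csqrt ((of_real x)\<^sup>2 - 1)))
             (of_real (sqrt (s / t)) * (of_real x - csqrt ((of_real x)\<^sup>2 - 1))))"

text \<open>
  Iterated integral of \<open>G [x\<^sub>2, \<dots>, x\<^sub>m]\<close> against
  \<open>P\<^bsub>s,t\<^sub>2\<^esub>(x, dx\<^sub>2) \<dots> P\<^bsub>t\<^sub>m\<^sub>-\<^sub>1,t\<^sub>m\<^esub>(x\<^sub>m\<^sub>-\<^sub>1, dx\<^sub>m)\<close>.
\<close>
primrec aw_transitions ::
  "real \<Rightarrow> real \<Rightarrow> real \<Rightarrow> real \<Rightarrow> real \<Rightarrow> real list \<Rightarrow> (real list \<Rightarrow> real) \<Rightarrow> real" where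
  "aw_transitions q a b s x [] G = G []"
| "aw_transitions q a b s x (t # ts) G =
     aw_P q a b s t x (\<lambda>y. aw_transitions q a b t y ts (\<lambda>ys. G (y # ys)))"

text \<open>Integral of \<open>G\<close> against \<open>\<pi>\<^sub>t\<^sub>1\<^sub>,\<^sub>\<dots>\<^sub>,\<^sub>t\<^sub>m\<close>.\<close>
primrec aw_joint ::
  "real \<Rightarrow> real \<Rightarrow> real \<Rightarrow> real \<Rightarrow> real \<Rightarrow> real list \<Rightarrow> (real list \<Rightarrow> real) \<Rightarrow> real" where
  "aw_joint q a b c d [] G = G []"
| "aw_joint q a b c d (t # ts) G =
     aw_pi q a b c d t (\<lambda>x. aw_transitions q a b t x ts (\<lambda>xs. G (x # xs)))"


section \<open>Measures on the configuration space\<close>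

text \<open>
  Configurations are functions on the positive integers (extensional, as in the library's product
  spaces), with occupation variables in \<open>bool\<close> instead of \<open>{0, 1}\<close>.
\<close>
definition configs :: "nat set \<Rightarrow> (nat \<Rightarrow> bool) measure" where
  "configs I = (\<Pi>\<^sub>M i\<in>I. count_space UNIV)"

definition marginal :: "nat \<Rightarrow> (nat \<Rightarrow> bool) measure \<Rightarrow> (nat \<Rightarrow> bool) measure" where
  "marginal m L = distr L (configs {1..m}) (\<lambda>\<tau>. restrict \<tau> {1..m})"

text \<open>The list entries \<open>ts ! i\<close> and \<open>xs ! i\<close> belong to the site \<open>Suc i\<close>.\<close>
definition high_density_measure ::
  "real \<Rightarrow> real \<Rightarrow> real \<Rightarrow> real \<Rightarrow> (nat \<Rightarrow> bool) measure \<Rightarrow> bool" where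
  "high_density_measure q A C D L \<longleftrightarrow>
     prob_space L \<and> sets L = sets (configs {1..}) \<and>
     (\<exists>\<epsilon>>0. \<forall>m\<ge>1. \<forall>ts. length ts = m \<and> sorted ts \<and> set ts \<subseteq> {1 - \<epsilon><..1} \<longrightarrow>
        (\<integral>\<tau>. (\<Prod>i<m. (ts ! i) ^ of_bool (\<tau> (Suc i))) \<partial>marginal m L) =
        A ^ m / (1 + A) ^ (2 * m) *
        aw_joint q A (1 / A) C D ts
          (\<lambda>xs. \<Prod>i<m. (1 + ts ! i + 2 * sqrt (ts ! i) * xs ! i)))"

definition product_bernoulli :: "real \<Rightarrow> (nat \<Rightarrow> bool) measure" where
  "product_bernoulli \<rho> = (\<Pi>\<^sub>M i\<in>{1..}. measure_pmf (bernoulli_pmf \<rho>))"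

end

theory Submission
  imports Defs
begin

text \<open>
  The condition \<open>AC = 1\<close> makes the first and third parameters of
  \<open>\<pi>\<^sub>t\<close> inverse to each other, and then \<open>\<pi>\<^sub>t\<close> and the relevant
  \<open>P\<^sub>s\<^sub>,\<^sub>t\<close> are point masses for \<open>s, t\<close> near 1; the generating function
  factorizes, and being multi-affine it determines \<open>\<lambda>\<^sub>m\<close>.

  Conversely, let \<open>\<lambda>\<close> be Bernoulli. With all times equal to \<open>t < 1\<close> and
  \<open>w(x) = 1 + t + 2 \<surd>t x\<close>, the generating functions say that
  \<open>\<integral> w\<^sup>n d\<pi>\<^sub>t = v\<^sup>n\<close> for all \<open>n \<ge> 1\<close> and some \<open>v > 0\<close>, so
  \<open>\<integral> w S(w) d\<pi>\<^sub>t = v S(v)\<close> for all polynomials \<open>S\<close>. Taking for \<open>S\<close> a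
  square vanishing at \<open>v\<close> and at the atoms, the density, which has constant sign, must
  vanish; its constant is zero only if \<open>A C q^n = 1\<close> for some \<open>n\<close>. Moreover
  \<open>\<pi>\<^sub>t\<close> has at most one atom of nonzero mass. But for \<open>n \<ge> 1\<close> the atom
  \<open>y\<^sub>0\<close> of the first parameter and one of \<open>y\<^sub>1\<close> (if \<open>A q > 1\<close>) or the atom
  \<open>y\<^sub>0\<close> of the third parameter (otherwise) have nonzero mass. No evaluation of the
  Askey--Wilson integral is needed.
\<close>

section \<open>Infinite q-Pochhammer symbols and the Askey--Wilson density\<close>

definition qpoch_inf1 :: "real \<Rightarrow> complex \<Rightarrow> complex" where
  "qpoch_inf1 q z = prodinf (\<lambda>j. 1 - z * of_real q ^ j)"

lemma qpoch_inf_eq_prod_list: "qpoch_inf q zs = (\<Prod>z\<leftarrow>zs. qpoch_inf1 q z)"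
  by (simp add: qpoch_inf_def qpoch_inf1_def)

lemma convergent_prod_qpoch:
  fixes z :: complex
  assumes "0 \<le> q" "q < 1"
  shows "convergent_prod (\<lambda>j. 1 - z * of_real q ^ j)"
proof -
  have "summable (\<lambda>j. norm z * q ^ j)"
    using assms by (intro summable_mult summable_geometric) auto
  then have "abs_convergent_prod (\<lambda>j. 1 - z * of_real q ^ j)"
    using assms by (simp add: abs_convergent_prod_conv_summable norm_mult norm_power)
  then show ?thesis
    by (rule abs_convergent_prod_imp_convergent_prod)
qed

lemma qpoch_inf1_LIMSEQ:
  assumes "0 \<le> q" "q < 1"
  shows "(\<lambda>n. \<Prod>j<n. 1 - z * of_real q ^ j) \<longlonglongrightarrow> qpoch_inf1 q z"
  using convergent_prod_LIMSEQ[OF convergent_prod_qpoch[OF assms], of z]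
  unfolding qpoch_inf1_def
  using LIMSEQ_lessThan_iff_atMost[of "\<lambda>A. \<Prod>j\<in>A. 1 - z * of_real q ^ j"] by blast

lemma qpoch_inf1_eq_0_iff:
  assumes "0 \<le> q" "q < 1"
  shows "qpoch_inf1 q z = 0 \<longleftrightarrow> (\<exists>j. z * of_real q ^ j = 1)"
proof -
  have "qpoch_inf1 q z = 0 \<longleftrightarrow> (\<exists>j. 1 - z * of_real q ^ j = 0)"
    using has_prod_eq_0_iff[OF convergent_prod_has_prod[OF convergent_prod_qpoch[OF assms, of z]]]
    by (auto simp: qpoch_inf1_def)
  then show ?thesis by (metis right_minus_eq)
qed

lemma qpoch_inf1_Reals:
  assumes "0 \<le> q" "q < 1" "z \<in> \<real>"
  shows "qpoch_inf1 q z \<in> \<real>"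
proof (rule Lim_in_closed_set[OF closed_complex_Reals _ _ qpoch_inf1_LIMSEQ])
  show "\<forall>\<^sub>F n in sequentially. (\<Prod>j<n. 1 - z * complex_of_real q ^ j) \<in> \<real>"
    using assms by (intro always_eventually allI prod_in_Reals) (auto intro!: Reals_diff Reals_mult Reals_power)
qed (use assms in auto)

text \<open>Triangle inequality in each factor: \<open>1 - z q^j\<close> has modulus at most
  \<open>1 + r q^j\<close>, with equality at \<open>z = - r\<close>. Passing to the limit gives a
  bound that is uniform on the disc of radius \<open>r\<close>.\<close>

lemma norm_qpoch_inf1_le:
  assumes "0 \<le> q" "q < 1" "norm z \<le> r"
  shows "norm (qpoch_inf1 q z) \<le> norm (qpoch_inf1 q (- of_real r))"
proof (rule LIMSEQ_le[OF tendsto_norm[OF qpoch_inf1_LIMSEQ] tendsto_norm[OF qpoch_inf1_LIMSEQ]])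
  have "norm (1 - z * of_real q ^ j) \<le> norm (1 - (- of_real r) * complex_of_real q ^ j)" for j
  proof -
    have "norm (1 - z * of_real q ^ j) \<le> 1 + norm z * q ^ j"
      using norm_triangle_ineq4[of 1 "z * of_real q ^ j"] assms by (simp add: norm_mult norm_power)
    also have "\<dots> \<le> 1 + r * q ^ j"
      using assms by (simp add: mult_right_mono)
    also have "\<dots> = norm (complex_of_real (1 + r * q ^ j))"
      using assms norm_ge_zero[of z] by (subst norm_of_real) (smt (verit) mult_nonneg_nonneg zero_le_power)
    finally show ?thesis by simp
  qed
  then show "\<exists>N. \<forall>n\<ge>N. norm (\<Prod>j<n. 1 - z * of_real q ^ j) \<le>
      norm (\<Prod>j<n. 1 - (- of_real r) * complex_of_real q ^ j)"
    unfolding prod_norm[symmetric] by (auto intro!: prod_mono)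
qed (use assms in auto)

text \<open>Reverse triangle inequality in each factor: on a circle around 0 the modulus is smallest
  at the positive real point. This bounds the denominators of the density from below.\<close>

lemma norm_qpoch_inf1_ge:
  assumes "0 \<le> q" "q < 1"
  shows "norm (qpoch_inf1 q (of_real (norm z))) \<le> norm (qpoch_inf1 q z)"
proof (rule LIMSEQ_le[OF tendsto_norm[OF qpoch_inf1_LIMSEQ] tendsto_norm[OF qpoch_inf1_LIMSEQ]])
  have "norm (1 - of_real (norm z) * complex_of_real q ^ j) \<le> norm (1 - z * of_real q ^ j)" for j
  proof -
    have "norm (1 - of_real (norm z) * complex_of_real q ^ j) = \<bar>1 - norm z * q ^ j\<bar>"
      by (metis norm_of_real of_real_1 of_real_diff of_real_mult of_real_power)
    also have "\<dots> \<le> norm (1 - z * of_real q ^ j)"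
      using norm_triangle_ineq3[of 1 "z * of_real q ^ j"] assms by (simp add: norm_mult norm_power)
    finally show ?thesis .
  qed
  then show "\<exists>N. \<forall>n\<ge>N. norm (\<Prod>j<n. 1 - of_real (norm z) * complex_of_real q ^ j) \<le>
      norm (\<Prod>j<n. 1 - z * complex_of_real q ^ j)"
    unfolding prod_norm[symmetric] by (auto intro!: prod_mono)
qed (use assms in auto)

text \<open>In the numerator of the density, where the argument lies on the unit circle, the head
  factor is the only one that can vanish; set apart, it compensates the singular factor
  \<open>1 / sqrt (1 - x\<^sup>2)\<close>.\<close>

lemma qpoch_inf1_split_head:
  assumes "0 \<le> q" "q < 1"
  shows "qpoch_inf1 q z = (1 - z) * qpoch_inf1 q (z * of_real q)"
proof (rule LIMSEQ_unique)
  show "(\<lambda>n. \<Prod>j<Suc n. 1 - z * of_real q ^ j) \<longlonglongrightarrow> qpoch_inf1 q z"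
    using qpoch_inf1_LIMSEQ[OF assms] by (rule LIMSEQ_Suc)
  show "(\<lambda>n. \<Prod>j<Suc n. 1 - z * of_real q ^ j) \<longlonglongrightarrow> (1 - z) * qpoch_inf1 q (z * of_real q)"
    using tendsto_mult_left[OF qpoch_inf1_LIMSEQ[OF assms], of "1 - z" "z * of_real q"]
    by (simp add: prod.lessThan_Suc_shift mult.assoc del: prod.lessThan_Suc)
qed

lemma borel_measurable_qpoch_inf1 [measurable (raw)]:
  assumes "0 \<le> q" "q < 1" and [measurable]: "h \<in> borel_measurable M"
  shows "(\<lambda>x. qpoch_inf1 q (h x)) \<in> borel_measurable M"
  by (rule borel_measurable_LIMSEQ_metric[OF _ qpoch_inf1_LIMSEQ[OF assms(1,2)]]) measurable

lemma qpoch_inf_eq_0_iff: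
  assumes "0 \<le> q" "q < 1"
  shows "qpoch_inf q zs = 0 \<longleftrightarrow> (\<exists>z\<in>set zs. \<exists>j. z * of_real q ^ j = 1)"
  unfolding qpoch_inf_eq_prod_list
  using qpoch_inf1_eq_0_iff[OF assms] by (force simp: prod_list_zero_iff)

lemma qpoch_inf_Reals:
  assumes "0 \<le> q" "q < 1" "set zs \<subseteq> \<real>"
  shows "qpoch_inf q zs \<in> \<real>"
  using assms(3) unfolding qpoch_inf_eq_prod_list
  by (induction zs) (auto intro!: Reals_mult qpoch_inf1_Reals[OF assms(1,2)])

text \<open>The part of the density that depends on \<open>x\<close>. The sign is left to the
  constant \<open>aw_const\<close>, so the density does not change sign where the weight is
  positive.\<close>

definition aw_weight :: "real \<Rightarrow> complex \<Rightarrow> complex \<Rightarrow> complex \<Rightarrow> complex \<Rightarrow> real \<Rightarrow> real" where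
  "aw_weight q a b c d x = (let z = cis (arccos x) in
     (norm (qpoch_inf q [z\<^sup>2] / qpoch_inf q [a * z, b * z, c * z, d * z]))\<^sup>2 / (2 * pi * sqrt (1 - x\<^sup>2)))"

definition aw_const :: "real \<Rightarrow> complex \<Rightarrow> complex \<Rightarrow> complex \<Rightarrow> complex \<Rightarrow> real" where
  "aw_const q a b c d =
     Re (qpoch_inf q [of_real q, a * b, a * c, a * d, b * c, b * d, c * d] / qpoch_inf q [a * b * c * d])"

lemma aw_density_eq: "aw_density q a b c d x = aw_const q a b c d * aw_weight q a b c d x"
  by (simp add: aw_density_def aw_weight_def aw_const_def Let_def)

text \<open>On the unit circle \<open>1 - z\<^sup>2 = z (cnj z - z)\<close>, and the bracket is
  \<open>-2 i\<close> times the sine of the angle.\<close>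

lemma norm_1_minus_cis_arccos_squared:
  assumes "-1 < x" "x < 1"
  shows "norm (1 - (cis (arccos x))\<^sup>2) = 2 * sqrt (1 - x\<^sup>2)"
proof -
  define z where "z = cis (arccos x)"
  have "1 - z\<^sup>2 = z * (cnj z - z)"
    using complex_norm_square[of z] by (simp add: z_def power2_eq_square algebra_simps)
  moreover have "cnj z - z = - (2 * \<i> * of_real (sin (arccos x)))"
    by (simp add: z_def complex_eq_iff)
  ultimately have "norm (1 - z\<^sup>2) = norm (2 * \<i> * of_real (sin (arccos x)))"
    by (simp add: norm_mult z_def)
  also have "\<dots> = 2 * sqrt (1 - x\<^sup>2)"
    using assms by (simp add: norm_mult sin_arccos power2_le_iff_abs_le abs_square_le_1)
  finally show ?thesis by (simp add: z_def)
qed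

lemma borel_measurable_aw_weight:
  assumes q: "0 \<le> q" "q < 1"
  shows "(\<lambda>x. indicator {-1<..<1} x * aw_weight q a b c d x) \<in> borel_measurable borel"
proof -
  \<comment> \<open>\<open>arccos\<close> and \<open>cis\<close> are traded for a formula that is
    visibly measurable on the whole line; the two agree on the open interval.\<close>
  define z where "z x = (complex_of_real x + \<i> * of_real (sqrt (1 - x\<^sup>2)))" for x
  have z: "cis (arccos x) = z x" if "x \<in> {-1<..<1}" for x
    using that by (simp add: z_def complex_eq_iff sin_arccos)
  have [measurable]: "z \<in> borel_measurable borel"
    unfolding z_def by measurable
  have "(\<lambda>x. indicator {-1<..<1} x * ((norm (qpoch_inf q [(z x)\<^sup>2] /
        qpoch_inf q [a * z x, b * z x, c * z x, d * z x]))\<^sup>2 / (2 * pi * sqrt (1 - x\<^sup>2))))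
      \<in> borel_measurable borel"
    using q unfolding qpoch_inf_eq_prod_list by simp
  also have "?this \<longleftrightarrow> ?thesis"
    by (intro measurable_cong) (auto simp: aw_weight_def Let_def z indicator_def)
  finally show ?thesis .
qed

section \<open>Positivity and boundedness of the weight for generic parameters\<close>

context
  fixes q :: real and a b c d :: complex
  assumes q: "0 \<le> q" "q < 1"
    and generic: "\<And>e j. e \<in> {a, b, c, d} \<Longrightarrow> norm e * q ^ j \<noteq> 1"
begin

text \<open>Genericity means that no factor \<open>1 - |e| q^j\<close> is zero. The symbol at
  \<open>|e|\<close> is therefore nonzero, and it is a lower bound on the whole circle of radius
  \<open>|e|\<close>.\<close>

lemma qpoch_inf1_circle_lower:
  assumes "e \<in> {a, b, c, d}" "norm z = 1"
  shows "0 < norm (qpoch_inf1 q (of_real (norm e)))" "norm (qpoch_inf1 q (of_real (norm e))) \<le> norm (qpoch_inf1 q (e * z))"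
proof -
  have "\<not> (\<exists>j. of_real (norm e) * complex_of_real q ^ j = 1)"
    using generic[OF assms(1)] by (metis of_real_1 of_real_eq_iff of_real_mult of_real_power)
  then show "0 < norm (qpoch_inf1 q (of_real (norm e)))"
    by (simp add: qpoch_inf1_eq_0_iff[OF q])
  show "norm (qpoch_inf1 q (of_real (norm e))) \<le> norm (qpoch_inf1 q (e * z))"
    using norm_qpoch_inf1_ge[OF q, of "e * z"] assms(2) by (simp add: norm_mult)
qed

lemma aw_weight_pos:
  assumes "x \<in> {-1<..<1}"
  shows "0 < aw_weight q a b c d x"
proof -
  define z where "z = cis (arccos x)"
  have x: "x\<^sup>2 < 1" using assms by (auto simp: abs_square_less_1)
  have nz: "norm z = 1" by (simp add: z_def)
  \<comment> \<open>The factors after the head cannot vanish, since their powers of \<open>q\<close>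
    have modulus below 1; the head \<open>1 - z\<^sup>2\<close> vanishes only at the
    endpoints.\<close>
  have "qpoch_inf1 q (z\<^sup>2 * of_real q) \<noteq> 0"
  proof
    assume "qpoch_inf1 q (z\<^sup>2 * of_real q) = 0"
    then obtain j where "z\<^sup>2 * of_real q * of_real q ^ j = 1"
      using qpoch_inf1_eq_0_iff[OF q] by blast
    then have "norm (z\<^sup>2 * of_real q * of_real q ^ j) = 1" by simp
    then have "q * q ^ j = 1" using q nz by (simp add: norm_mult norm_power)
    moreover have "q * q ^ j \<le> q * 1" using q by (intro mult_left_mono power_le_one) auto
    ultimately show False using q by simp
  qed
  moreover have "norm (1 - z\<^sup>2) \<noteq> 0"
    using norm_1_minus_cis_arccos_squared[of x] assms x by (simp add: z_def)
  ultimately have "qpoch_inf1 q (z\<^sup>2) \<noteq> 0"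
    by (subst qpoch_inf1_split_head[OF q]) simp
  moreover have "qpoch_inf1 q (e * z) \<noteq> 0" if "e \<in> {a, b, c, d}" for e
    using qpoch_inf1_circle_lower[OF that nz] by auto
  ultimately show ?thesis
    using x by (simp add: aw_weight_def Let_def qpoch_inf_eq_prod_list z_def[symmetric])
qed

text \<open>With \<open>s = sqrt (1 - x\<^sup>2)\<close>, the squared numerator is at most of order
  \<open>s\<^sup>2\<close>, which outweighs the explicit factor \<open>1 / s\<close>, and the
  denominators stay away from 0.\<close>

lemma aw_weight_bounded: "\<exists>M. \<forall>x\<in>{-1<..<1}. aw_weight q a b c d x \<le> M"
proof (intro exI ballI)
  fix x :: real assume x: "x \<in> {-1<..<1}"
  define z where "z = cis (arccos x)"
  define s where "s = sqrt (1 - x\<^sup>2)"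
  define M where "M = norm (qpoch_inf1 q (- of_real 1))"
  have M_nonneg: "0 \<le> M" by (simp add: M_def)
  let ?m = "\<lambda>e. norm (qpoch_inf1 q (of_real (norm e)))"
  have x2: "x\<^sup>2 < 1" using x by (auto simp: abs_square_less_1)
  then have s: "0 < s" "s \<le> 1" by (auto simp: s_def)
  have nz: "norm z = 1" by (simp add: z_def)
  have "norm (qpoch_inf1 q (z\<^sup>2)) = 2 * s * norm (qpoch_inf1 q (z\<^sup>2 * of_real q))"
    using norm_1_minus_cis_arccos_squared[of x] x
    by (subst qpoch_inf1_split_head[OF q]) (simp add: norm_mult z_def s_def)
  also have "norm (qpoch_inf1 q (z\<^sup>2 * of_real q)) \<le> M"
    unfolding M_def using q nz by (intro norm_qpoch_inf1_le) (auto simp: norm_mult norm_power)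
  finally have num: "norm (qpoch_inf1 q (z\<^sup>2)) \<le> 2 * s * M" using s by simp
  have den: "?m a * ?m b * ?m c * ?m d \<le>
      norm (qpoch_inf1 q (a * z)) * norm (qpoch_inf1 q (b * z)) * norm (qpoch_inf1 q (c * z)) * norm (qpoch_inf1 q (d * z))"
    using qpoch_inf1_circle_lower[OF _ nz] by (intro mult_mono mult_nonneg_nonneg) auto
  have den0: "0 < ?m a * ?m b * ?m c * ?m d"
    using qpoch_inf1_circle_lower(1)[of _ 1] by simp
  have "norm (qpoch_inf q [z\<^sup>2] / qpoch_inf q [a * z, b * z, c * z, d * z]) \<le>
      2 * s * M / (?m a * ?m b * ?m c * ?m d)"
    unfolding norm_divide using num den den0
    by (intro frac_le) (auto simp: qpoch_inf_eq_prod_list norm_mult mult.assoc s(1) less_imp_le M_nonneg)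
  then have "(norm (qpoch_inf q [z\<^sup>2] / qpoch_inf q [a * z, b * z, c * z, d * z]))\<^sup>2 \<le>
      (2 * s * M / (?m a * ?m b * ?m c * ?m d))\<^sup>2"
    by (intro power_mono) auto
  then have "aw_weight q a b c d x \<le> (2 * s * M / (?m a * ?m b * ?m c * ?m d))\<^sup>2 / (2 * pi * s)"
    unfolding aw_weight_def Let_def z_def[symmetric] s_def[symmetric] using s
    by (intro divide_right_mono) auto
  also have "\<dots> = s * (2 * M\<^sup>2 / (?m a * ?m b * ?m c * ?m d)\<^sup>2 / pi)"
    using s by (simp add: power2_eq_square field_simps)
  also have "\<dots> \<le> 1 * (2 * M\<^sup>2 / (?m a * ?m b * ?m c * ?m d)\<^sup>2 / pi)"
    using s by (intro mult_right_mono) auto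
  finally show "aw_weight q a b c d x \<le> 1 * (2 * M\<^sup>2 / (?m a * ?m b * ?m c * ?m d)\<^sup>2 / pi)"
    unfolding M_def .
qed

lemma set_integrable_aw_weight:
  assumes g: "continuous_on UNIV (g :: real \<Rightarrow> real)"
  shows "set_integrable lborel {-1<..<1} (\<lambda>x. aw_weight q a b c d x * g x)"
proof -
  obtain M where M: "\<And>x. x \<in> {-1<..<1} \<Longrightarrow> aw_weight q a b c d x \<le> M"
    using aw_weight_bounded by blast
  have "bounded (g ` {-1..1})"
    by (intro compact_imp_bounded compact_continuous_image continuous_on_subset[OF g]) auto
  then obtain N where N: "\<And>x. x \<in> {-1..1} \<Longrightarrow> norm (g x) \<le> N"
    unfolding bounded_iff by blast
  have [measurable]: "g \<in> borel_measurable borel"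
    using g by (rule borel_measurable_continuous_onI)
  note [measurable] = borel_measurable_aw_weight[OF q]
  have "integrable lborel (\<lambda>x. (indicator {-1<..<1} x * aw_weight q a b c d x) * g x)"
  proof (rule integrableI_bounded_set[where A = "{-1<..<1}" and B = "M * N"])
    show "AE x\<in>{-1<..<1} in lborel. norm (indicator {-1<..<1} x * aw_weight q a b c d x * g x) \<le> M * N"
    proof (intro AE_I2 impI)
      fix x :: real assume x: "x \<in> {-1<..<1}"
      have "\<bar>aw_weight q a b c d x\<bar> * \<bar>g x\<bar> \<le> M * N"
        using M[OF x] N[of x] aw_weight_pos[OF x] x by (intro mult_mono) auto
      then show "norm (indicator {-1<..<1} x * aw_weight q a b c d x * g x) \<le> M * N"
        using x by (simp add: abs_mult)
    qed
  qed auto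
  then show ?thesis by (simp add: set_integrable_def mult.assoc)
qed

end

section \<open>Measures on the configuration space\<close>

lemma sets_product_bernoulli: "sets (product_bernoulli \<rho>) = sets (configs {1..})"
  unfolding product_bernoulli_def configs_def by (intro sets_PiM_cong) auto

lemma prob_space_product_bernoulli: "prob_space (product_bernoulli \<rho>)"
  unfolding product_bernoulli_def by (intro prob_space_PiM) (rule prob_space_measure_pmf)

lemma measurable_cylinder_prod:
  fixes g :: "nat \<Rightarrow> bool \<Rightarrow> real"
  assumes "{1..m} \<subseteq> I" "sets L = sets (configs I)"
  shows "(\<lambda>\<tau>. \<Prod>i<m. g i (\<tau> (Suc i))) \<in> borel_measurable L"
proof -
  have "(\<lambda>\<tau>. g i (\<tau> (Suc i))) \<in> borel_measurable (configs I)" if "i < m" for i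
    unfolding configs_def
    by (rule measurable_compose[OF measurable_component_singleton]) (use that assms(1) in auto)
  then show ?thesis
    unfolding measurable_cong_sets[OF assms(2) refl] by (intro borel_measurable_prod) auto
qed

lemma integrable_cylinder_prod:
  fixes g :: "nat \<Rightarrow> bool \<Rightarrow> real"
  assumes "prob_space L" "{1..m} \<subseteq> I" "sets L = sets (configs I)"
  shows "integrable L (\<lambda>\<tau>. \<Prod>i<m. g i (\<tau> (Suc i)))"
proof -
  interpret prob_space L by fact
  have "norm (\<Prod>i<m. g i (\<tau> (Suc i))) \<le> (\<Prod>i<m. \<bar>g i True\<bar> + \<bar>g i False\<bar>)" for \<tau>
    unfolding real_norm_def abs_prod
    by (intro prod_mono conjI abs_ge_zero) (case_tac "\<tau> (Suc i)", auto)
  then show ?thesis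
    by (intro integrable_const_bound[where B = "\<Prod>i<m. \<bar>g i True\<bar> + \<bar>g i False\<bar>"]
        measurable_cylinder_prod[OF assms(2,3)] AE_I2)
qed

lemma integral_marginal:
  fixes g :: "nat \<Rightarrow> bool \<Rightarrow> real"
  assumes "sets L = sets (configs {1..})"
  shows "(\<integral>\<tau>. (\<Prod>i<m. g i (\<tau> (Suc i))) \<partial>marginal m L) = (\<integral>\<tau>. (\<Prod>i<m. g i (\<tau> (Suc i))) \<partial>L)"
proof -
  have "(\<lambda>\<tau>. restrict \<tau> {1..m}) \<in> configs {1..} \<rightarrow>\<^sub>M configs {1..m}"
    unfolding configs_def by (rule measurable_restrict_subset) auto
  then have "(\<lambda>\<tau>. restrict \<tau> {1..m}) \<in> L \<rightarrow>\<^sub>M configs {1..m}"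
    unfolding measurable_cong_sets[OF assms refl] .
  then show ?thesis
    unfolding marginal_def
    by (subst integral_distr) (auto intro!: measurable_cylinder_prod Bochner_Integration.integral_cong)
qed

lemma integral_product_bernoulli:
  fixes g :: "nat \<Rightarrow> bool \<Rightarrow> real"
  assumes "0 \<le> \<rho>" "\<rho> \<le> 1"
  shows "(\<integral>\<tau>. (\<Prod>i<m. g i (\<tau> (Suc i))) \<partial>product_bernoulli \<rho>) =
    (\<Prod>i<m. \<rho> * g i True + (1 - \<rho>) * g i False)"
proof -
  let ?M = "\<lambda>_::nat. measure_pmf (bernoulli_pmf \<rho>)"
  interpret product_prob_space ?M "{1..}" by unfold_locales
  have m: "marginal m (product_bernoulli \<rho>) = PiM {1..m} ?M"
  proof -
    have "marginal m (product_bernoulli \<rho>) =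
        distr (PiM {1..} ?M) (PiM {1..m} ?M) (\<lambda>\<tau>. restrict \<tau> {1..m})"
      unfolding marginal_def product_bernoulli_def configs_def
      by (intro distr_cong sets_PiM_cong) auto
    also have "\<dots> = PiM {1..m} ?M"
      by (rule distr_PiM_restrict_finite) auto
    finally show ?thesis .
  qed
  have "(\<integral>\<tau>. (\<Prod>i<m. g i (\<tau> (Suc i))) \<partial>product_bernoulli \<rho>) =
      (\<integral>\<tau>. (\<Prod>j\<in>{1..m}. g (j - 1) (\<tau> j)) \<partial>PiM {1..m} ?M)"
    unfolding integral_marginal[OF sets_product_bernoulli, symmetric] m
    by (simp add: prod.atLeast1_atMost_eq)
  also have "\<dots> = (\<Prod>j\<in>{1..m}. integral\<^sup>L (measure_pmf (bernoulli_pmf \<rho>)) (g (j - 1)))"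
    by (intro product_integral_prod) (auto intro!: integrable_measure_pmf_finite)
  also have "\<dots> = (\<Prod>i<m. \<rho> * g i True + (1 - \<rho>) * g i False)"
    using assms by (simp add: prod.atLeast1_atMost_eq mult.commute)
  finally show ?thesis .
qed

text \<open>With indicators as factors the integral is the probability of a cylinder set, and
  cylinder sets determine a probability measure on the product space.\<close>

lemma measure_eqI_cylinder_prod:
  assumes L: "prob_space L" "sets L = sets (configs {1..})"
    and L': "prob_space L'" "sets L' = sets (configs {1..})"
    and eq: "\<And>m (g :: nat \<Rightarrow> bool \<Rightarrow> real).
      (\<integral>\<tau>. (\<Prod>i<m. g i (\<tau> (Suc i))) \<partial>L) = (\<integral>\<tau>. (\<Prod>i<m. g i (\<tau> (Suc i))) \<partial>L')"
  shows "L = L'"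
proof -
  interpret L: prob_space L by fact
  interpret L': prob_space L' by fact
  let ?M = "\<lambda>_::nat. count_space (UNIV :: bool set)"
  show ?thesis
  proof (rule measure_eqI_PiM_infinite[of L "{1..}" ?M L'])
    fix A :: "nat \<Rightarrow> bool set" and J :: "nat set"
    assume J: "finite J" "J \<subseteq> {1..}"
    let ?E = "prod_emb {1..} ?M J (Pi\<^sub>E J A)"
    obtain m where m: "J \<subseteq> {1..m}"
      using J finite_nat_iff_bounded_le[of J] by (auto simp: subset_eq)
    define g :: "nat \<Rightarrow> bool \<Rightarrow> real"
      where "g i b = (if Suc i \<in> J then indicator (A (Suc i)) b else 1)" for i b
    have meas: "measure N ?E = (\<integral>\<tau>. (\<Prod>i<m. g i (\<tau> (Suc i))) \<partial>N)"
      if "prob_space N" and N: "sets N = sets (configs {1..})" for N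
    proof -
      interpret prob_space N by fact
      have sp: "space N = space (PiM {1..} ?M)"
        using sets_eq_imp_space_eq[OF N] by (simp add: configs_def)
      have E: "?E \<in> sets N"
        unfolding N configs_def using J by (intro sets_PiM_I) auto
      have "measure N ?E = (\<integral>\<tau>. indicator ?E \<tau> \<partial>N)"
        using E by simp
      also have "\<dots> = (\<integral>\<tau>. (\<Prod>i<m. g i (\<tau> (Suc i))) \<partial>N)"
      proof (intro Bochner_Integration.integral_cong refl)
        fix \<tau> assume "\<tau> \<in> space N"
        then have "\<tau> \<in> ?E \<longleftrightarrow> (\<forall>j\<in>J. \<tau> j \<in> A j)"
          by (auto simp: sp space_PiM prod_emb_def PiE_iff)
        also have "\<dots> \<longleftrightarrow> (\<forall>i<m. g i (\<tau> (Suc i)) = 1)"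
        proof safe
          fix j assume *: "\<forall>i<m. g i (\<tau> (Suc i)) = 1" and j: "j \<in> J"
          have "j - 1 < m" "Suc (j - 1) = j" using j m by fastforce+
          then show "\<tau> j \<in> A j"
            using * j unfolding g_def by (metis indicator_eq_1_iff)
        qed (auto simp: g_def)
        finally have *: "\<tau> \<in> ?E \<longleftrightarrow> (\<forall>i<m. g i (\<tau> (Suc i)) = 1)" .
        have "g i b = 0 \<or> g i b = 1" for i b by (auto simp: g_def indicator_def)
        then have "(\<Prod>i<m. g i (\<tau> (Suc i))) = of_bool (\<forall>i<m. g i (\<tau> (Suc i)) = 1)"
          by (auto intro!: prod_zero)
        then show "indicator ?E \<tau> = (\<Prod>i<m. g i (\<tau> (Suc i)))"
          using * by (simp add: indicator_def)
      qed
      finally show ?thesis .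
    qed
    show "emeasure L ?E = emeasure L' ?E"
      unfolding L.emeasure_eq_measure L'.emeasure_eq_measure meas[OF L] meas[OF L'] eq ..
  qed (use L L' in \<open>auto simp: configs_def intro: L.finite_measure_axioms\<close>)
qed

text \<open>
  Two multi-affine functions of \<open>t\<^sub>1, \<dots>, t\<^sub>m\<close> that agree for increasing
  arguments in an interval agree everywhere: free the arguments one at a time from the left,
  \<open>t\<^sub>k\<close> still ranges over an interval when the later ones are fixed.
\<close>
lemma multilinear_eq_of_sorted:
  fixes \<Phi> \<Psi> :: "(nat \<Rightarrow> bool \<Rightarrow> real) \<Rightarrow> real"
  assumes eps: "0 < \<epsilon>"
    and \<Phi>: "\<And>g k x y f h. k < m \<Longrightarrow> \<Phi> (g(k := \<lambda>b. x * f b + y * h b)) = x * \<Phi> (g(k := f)) + y * \<Phi> (g(k := h))"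
    and \<Psi>: "\<And>g k x y f h. k < m \<Longrightarrow> \<Psi> (g(k := \<lambda>b. x * f b + y * h b)) = x * \<Psi> (g(k := f)) + y * \<Psi> (g(k := h))"
    and eq: "\<And>g t. (\<And>i. i < m \<Longrightarrow> g i = (\<lambda>b. t i ^ of_bool b)) \<Longrightarrow>
      (\<And>i. i < m \<Longrightarrow> 1 - \<epsilon> < t i \<and> t i \<le> 1) \<Longrightarrow> mono_on {..<m} t \<Longrightarrow> \<Phi> g = \<Psi> g"
  shows "\<Phi> g = \<Psi> g"
proof -
  \<comment> \<open>Induction on the number \<open>n\<close> of leading functions that are already
    arbitrary; from index \<open>n\<close> on they are still powers of sorted numbers.\<close>
  have "\<Phi> g = \<Psi> g"
    if "n \<le> m"
      "\<And>i. n \<le> i \<Longrightarrow> i < m \<Longrightarrow> g i = (\<lambda>b. t i ^ of_bool b)"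
      "\<And>i. n \<le> i \<Longrightarrow> i < m \<Longrightarrow> 1 - \<epsilon> < t i \<and> t i \<le> 1"
      "mono_on {n..<m} t" for n g t
    using that
  proof (induction n arbitrary: g t)
    case 0
    then show ?case by (intro eq[of g t]) (auto simp: lessThan_atLeast0)
  next
    case (Suc n)
    \<comment> \<open>The upper end of the range left for the argument with index \<open>n\<close>:
      the next argument, or 1 if there is none.\<close>
    define u where "u = (if Suc n < m then t (Suc n) else 1)"
    define s where "s = (u + (1 - \<epsilon>)) / 2"
    have u: "1 - \<epsilon> < u" "u \<le> 1" using Suc.prems(3)[of "Suc n"] eps by (auto simp: u_def)
    then have s: "1 - \<epsilon> < s" "s < u" "s \<le> 1" by (auto simp: s_def)
    have step: "\<Phi> (g(n := \<lambda>b. r ^ of_bool b)) = \<Psi> (g(n := \<lambda>b. r ^ of_bool b))"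
      if r: "1 - \<epsilon> < r" "r \<le> u" for r
    proof (rule Suc.IH[where t = "t(n := r)"])
      have "r \<le> t j" if "Suc n \<le> j" "j < m" for j
      proof -
        have "u = t (Suc n)" using that by (simp add: u_def)
        also have "\<dots> \<le> t j"
          using Suc.prems(4) that by (auto simp: mono_on_def)
        finally show ?thesis using r by simp
      qed
      then show "mono_on {n..<m} (t(n := r))"
        using Suc.prems(4) by (auto simp: mono_on_def)
    qed (use Suc.prems r u in auto)
    define x y where "x = (g n True - u * g n False) / (s - u)" and "y = g n False - x"
    have "x * (s - u) = g n True - u * g n False" using s by (simp add: x_def)
    then have "g n = (\<lambda>b. x * s ^ of_bool b + y * u ^ of_bool b)"
      by (auto simp: fun_eq_iff y_def all_bool_eq algebra_simps)
    then have g: "g = g(n := \<lambda>b. x * s ^ of_bool b + y * u ^ of_bool b)"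
      by (metis fun_upd_triv)
    have "n < m" using Suc.prems(1) by simp
    then show ?case
      using step[of s] step[of u] s u by (subst (1 2) g) (simp add: \<Phi> \<Psi>)
  qed
  from this[of m g] show ?thesis by (auto simp: mono_on_def)
qed

section \<open>The degenerate case\<close>

lemma qpoch_inf1_ne_0:
  assumes "0 \<le> q" "q < 1" "norm z < 1"
  shows "qpoch_inf1 q z \<noteq> 0"
proof
  assume "qpoch_inf1 q z = 0"
  then obtain j where j: "z * of_real q ^ j = 1"
    using qpoch_inf1_eq_0_iff[OF assms(1,2)] by blast
  have "norm (z * of_real q ^ j) = norm z * q ^ j"
    using assms by (simp add: norm_mult norm_power)
  also have "\<dots> \<le> norm z * 1"
    using assms by (intro mult_left_mono power_le_one) auto
  finally show False using j assms(3) by simp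
qed

lemma aw_atoms_empty:
  assumes "0 \<le> q" "q < 1" "norm e < 1"
  shows "{k. 1 \<le> norm (e * complex_of_real q ^ k)} = {}"
proof -
  have "norm (e * complex_of_real q ^ k) < 1" for k
  proof -
    have "norm (e * complex_of_real q ^ k) = norm e * q ^ k"
      using assms by (simp add: norm_mult norm_power)
    also have "\<dots> \<le> norm e * 1"
      using assms by (intro mult_left_mono power_le_one) auto
    finally show ?thesis using assms by simp
  qed
  then show ?thesis by (simp add: not_le)
qed

lemma aw_atoms_finite:
  assumes "0 \<le> q" "q < 1"
  shows "finite {k. 1 \<le> norm (e * complex_of_real q ^ k)}"
proof -
  have "(\<lambda>k. norm e * q ^ k) \<longlonglongrightarrow> norm e * 0"
    using assms by (intro tendsto_mult_left LIMSEQ_power_zero) auto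
  then have "\<forall>\<^sub>F k in sequentially. norm e * q ^ k < 1"
    by (rule order_tendstoD) simp
  then obtain N where "\<And>k. k \<ge> N \<Longrightarrow> norm e * q ^ k < 1"
    by (auto simp: eventually_sequentially)
  then have "{k. 1 \<le> norm (e * complex_of_real q ^ k)} \<subseteq> {..<N}"
    using assms by (auto simp: norm_mult norm_power) (meson not_le)
  then show ?thesis by (rule finite_subset) simp
qed

lemma qpoch_1_eq_0:
  assumes "1 \<in> set zs" "0 < k"
  shows "qpoch q zs k = 0"
proof -
  have "(\<Prod>j<k. 1 - 1 * complex_of_real q ^ j) = 0"
    using assms(2) by (intro prod_zero) (auto intro: bexI[of _ 0])
  then show ?thesis
    using assms(1) unfolding qpoch_def prod_list_zero_iff by force
qed

lemma aw_const_eq_0: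
  assumes "0 \<le> q" "q < 1" "a * c = 1 \<or> a * d = 1"
  shows "aw_const q a b c d = 0"
proof -
  have "qpoch_inf q [of_real q, a * b, a * c, a * d, b * c, b * d, c * d] = 0"
    unfolding qpoch_inf_eq_0_iff[OF assms(1,2)] using assms(3) by (auto intro: exI[of _ 0])
  then show ?thesis by (simp add: aw_const_def)
qed

text \<open>A product equal to 1 puts the factor \<open>(1)_inf = 0\<close> into the density and
  \<open>(1)_k = 0\<close> into the masses of the atoms of \<open>a\<close> with
  \<open>k \<ge> 1\<close>. The atom of \<open>a\<close> with \<open>k = 0\<close> has mass 1 by
  cancellation, and no other parameter contributes.\<close>

lemma aw_measure_degenerate:
  fixes a b c d :: complex
  assumes q: "0 \<le> q" "q < 1"
    and Om: "(a, b, c, d) \<in> aw_Omega q"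
    and norms: "1 < norm a" "norm b < 1" "norm d < 1"
    and degen: "a * d = 1 \<or> a * c = 1"
  shows "aw_measure q a b c d g = g (Re ((a + inverse a) / 2))"
proof -
  let ?K = "\<lambda>e. {k. 1 \<le> norm (e * complex_of_real q ^ k)}"
  have a0: "a \<noteq> 0" using norms by auto
  \<comment> \<open>The modulus of \<open>c\<close> may be 1 or more, as happens for transition
    measures; then the separation condition of \<open>aw_Omega\<close> rules out
    \<open>a = q^j c\<close>.\<close>
  have ca: "qpoch_inf1 q (c / a) \<noteq> 0"
  proof (cases "norm c < 1")
    case True
    then show ?thesis using norms by (intro qpoch_inf1_ne_0 q) (simp add: norm_divide divide_less_eq)
  next
    case False
    have "\<forall>l. a \<noteq> of_real q ^ l * c"
    proof -
      have "\<forall>i<4. \<forall>j<4. i \<noteq> j \<longrightarrow>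
        norm ([a, b, c, d] ! i) \<ge> 1 \<longrightarrow> norm ([a, b, c, d] ! j) \<ge> 1 \<longrightarrow>
        (\<forall>l::nat. [a, b, c, d] ! i \<noteq> of_real q ^ l * [a, b, c, d] ! j)"
        using Om by (simp add: aw_Omega_def)
      from this[rule_format, of 0 2] show ?thesis using norms False by simp
    qed
    then show ?thesis using a0 by (auto simp: qpoch_inf1_eq_0_iff[OF q] field_simps)
  qed
  have ba: "qpoch_inf1 q (b / a) \<noteq> 0" and da: "qpoch_inf1 q (d / a) \<noteq> 0"
    using norms by (intro qpoch_inf1_ne_0 q, simp add: norm_divide divide_less_eq)+
  have abcd: "qpoch_inf1 q (a * b * c * d) \<noteq> 0"
    using Om unfolding qpoch_inf1_eq_0_iff[OF q] by (auto simp: aw_Omega_def mult.commute)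
  have mass0: "aw_mass0 q a b c d = 1"
    using degen
  proof
    assume ad: "a * d = 1"
    then have d: "d = inverse a" using a0 by (simp add: field_simps)
    \<comment> \<open>After substituting the inverse of \<open>a\<close>, the four numerator
      arguments are a permutation of the four denominator arguments.\<close>
    have eqs: "inverse (a\<^sup>2) = d / a" "b * c = a * b * c * d" "b * d = b / a" "c * d = c / a"
      using a0 unfolding d by (auto simp: field_simps power2_eq_square)
    show ?thesis
      using ca ba da abcd unfolding aw_mass0_def qpoch_inf_eq_prod_list
      unfolding eqs by (simp add: field_simps)
  next
    assume ac: "a * c = 1"
    then have c: "c = inverse a" using a0 by (simp add: field_simps)
    have eqs: "inverse (a\<^sup>2) = c / a" "b * c = b / a" "b * d = a * b * c * d" "c * d = d / a"
      using a0 unfolding c by (auto simp: field_simps power2_eq_square)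
    show ?thesis
      using ca ba da abcd unfolding aw_mass0_def qpoch_inf_eq_prod_list
      unfolding eqs by (simp add: field_simps)
  qed
  have mass_a: "aw_mass q a b c d k = of_bool (k = 0)" for k
  proof (cases "k = 0")
    case False
    then have "qpoch q [a\<^sup>2, a * b, a * c, a * d] k = 0"
      using degen by (intro qpoch_1_eq_0) auto
    then show ?thesis using False by (simp add: aw_mass_def)
  qed (simp add: aw_mass_def mass0)
  have sum_a: "(\<Sum>k\<in>?K a. aw_mass q a b c d k * g (aw_atom q a k)) = g (aw_atom q a 0)"
  proof -
    have "(\<Sum>k\<in>?K a. aw_mass q a b c d k * g (aw_atom q a k)) = (\<Sum>k\<in>{0}. g (aw_atom q a k))"
      using norms by (intro sum.mono_neutral_cong_right aw_atoms_finite q) (auto simp: mass_a)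
    then show ?thesis by simp
  qed
  \<comment> \<open>If \<open>a * d = 1\<close>, every mass generated by \<open>c\<close> contains
    the vanishing symbol of \<open>a * d\<close>. If \<open>a * c = 1\<close>, then \<open>c\<close>
    has modulus below 1 and generates no atom.\<close>
  have sum_c: "(\<Sum>k\<in>?K c. aw_mass q c b a d k * g (aw_atom q c k)) = 0"
  proof (cases "a * d = 1")
    case True
    then have "qpoch_inf q [inverse (c\<^sup>2), b * a, b * d, a * d] = 0"
      unfolding qpoch_inf_eq_0_iff[OF q] by (auto intro: exI[of _ 0])
    then have "aw_mass q c b a d k = 0" for k
      by (simp add: aw_mass_def aw_mass0_def Let_def)
    then show ?thesis by simp
  next
    case False
    then have "norm a * norm c = 1" using degen by (metis norm_mult norm_one)
    then have "norm c < 1"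
      using norms by (smt (verit) mult_less_cancel_right2 norm_ge_zero mult.commute)
    then show ?thesis by (simp add: aw_atoms_empty[OF q])
  qed
  have "aw_density q a b c d x = 0" for x
    using aw_const_eq_0[OF q, of a c d b] degen by (auto simp: aw_density_eq)
  then show ?thesis
    using Om by (simp add: aw_measure_def sum_a sum_c aw_atoms_empty[OF q] norms)
      (simp add: aw_atom_def)
qed

text \<open>The first atom generated by the parameter \<open>A * sqrt t\<close>. At
  \<open>t = 1\<close> it is the point fixed by the convention, so one formula serves all
  times.\<close>

definition aw_point :: "real \<Rightarrow> real \<Rightarrow> real" where
  "aw_point A t = (A * sqrt t + 1 / (A * sqrt t)) / 2"

text \<open>The first and third parameters are inverse to each other. Only the first has modulus at
  least 1, so the separation condition of \<open>aw_Omega\<close> is vacuous.\<close>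

lemma aw_pi_degenerate:
  fixes A D t :: real
  assumes q: "0 \<le> q" "q < 1"
    and A: "1 < A" and D: "D \<le> 0" and t: "0 < t" "t \<le> 1" "1 < A * sqrt t" "\<bar>D\<bar> < sqrt t"
  shows "aw_pi q A (1 / A) (1 / A) D t g = g (aw_point A t)"
proof (cases "t = 1")
  case True
  then show ?thesis using A by (simp add: aw_pi_def dirac_def aw_point_def)
next
  case False
  define a b c d where "a = A * sqrt t" "b = 1 / A * sqrt t" "c = 1 / A / sqrt t" "d = D / sqrt t"
  note defs = this
  have t1: "t < 1" using False t by simp
  have st: "0 < sqrt t" "sqrt t < 1" "sqrt t * sqrt t = t" using t t1 by auto
  have ab: "a * b = t" and ac: "a * c = 1" and cd: "c * d \<le> 0"
    using A st D t by (auto simp: defs field_simps mult_nonneg_nonpos)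
  have abcd: "a * b * c * d \<le> 0"
    using cd ab t by (metis mult.assoc mult_nonneg_nonpos less_imp_le)
  have na: "1 < \<bar>a\<bar>" and nb: "\<bar>b\<bar> < 1" and nc: "\<bar>c\<bar> < 1" and nd: "\<bar>d\<bar> < 1"
    using A t st less_trans[OF st(2) A] by (auto simp: defs abs_mult)
  have lt: "\<bar>[a, b, c, d] ! i\<bar> < 1" if "i < 4" "i \<noteq> 0" for i
    using that nb nc nd by (auto simp: less_Suc_eq numeral_eq_Suc)
  have nth: "[complex_of_real a, of_real b, of_real c, of_real d] ! i = of_real ([a, b, c, d] ! i)"
    if "i < 4" for i using that by (auto simp: less_Suc_eq numeral_eq_Suc)
  have l: "complex_of_real q ^ l * (of_real a * of_real b * of_real c * of_real d) \<noteq> 1" for l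
  proof -
    have "q ^ l * (a * b * c * d) \<le> 0" using abcd q by (simp add: mult_nonneg_nonpos)
    then have "q ^ l * (a * b * c * d) \<noteq> 1" by linarith
    then show ?thesis by (metis of_real_mult of_real_power of_real_1 of_real_eq_iff)
  qed
  have Om: "(complex_of_real a, complex_of_real b, complex_of_real c, complex_of_real d) \<in> aw_Omega q"
    unfolding aw_Omega_def using ab t1 cd l by (auto simp: nth) (metis lt not_le)
  have "aw_pi q A (1 / A) (1 / A) D t g = aw_measure q (of_real a) (of_real b) (of_real c) (of_real d) g"
    using False by (simp add: aw_pi_def defs)
  also have "\<dots> = g (Re ((complex_of_real a + inverse (of_real a)) / 2))"
    using na nb nd ac by (intro aw_measure_degenerate q Om) (auto simp flip: of_real_mult)
  also have "Re ((complex_of_real a + inverse (of_real a)) / 2) = aw_point A t"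
    by (simp add: aw_point_def defs field_simps flip: of_real_inverse of_real_add)
  finally show ?thesis .
qed

text \<open>With \<open>u = A * sqrt s\<close>, the starting point is
  \<open>(u + 1 / u) / 2\<close>, so the last two parameters are \<open>sqrt (s / t)\<close> times
  \<open>u\<close> and \<open>1 / u\<close>. They equal \<open>a * (s / t)\<close> and
  \<open>1 / a\<close>: the first and fourth parameters are inverse to each other.\<close>

lemma aw_P_degenerate:
  fixes A s t :: real
  assumes q: "0 \<le> q" "q < 1"
    and A: "1 < A" and s: "q < s" "s \<le> t" "1 < A * sqrt s" and t: "t \<le> 1"
  shows "aw_P q A (1 / A) s t (aw_point A s) g = g (aw_point A t)"
proof (cases "s = t \<or> t = 1")
  case True
  then show ?thesis using A by (auto simp: aw_P_def dirac_def aw_point_def)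
next
  case False
  define u where "u = A * sqrt s"
  define a b c d where "a = A * sqrt t" "b = 1 / A * sqrt t" "c = sqrt (s / t) * u" "d = sqrt (s / t) / u"
  note defs = this
  have st: "s < t" "t < 1" "0 < s" "0 < t" using False s t q by auto
  have u: "1 < u" using s by (simp add: u_def)
  have sq: "0 < sqrt t" "sqrt t < 1" "sqrt t * sqrt t = t" "0 < sqrt s" "sqrt s * sqrt s = s"
    "sqrt s < sqrt t"
    using st by auto
  have c: "c = a * (s / t)"
    using sq A by (simp add: defs u_def real_sqrt_divide field_simps)
  have d: "d = 1 / a"
    using sq A by (simp add: defs u_def real_sqrt_divide field_simps)
  have a: "1 < a"
    using u sq A unfolding defs u_def by (smt (verit) mult_strict_left_mono)
  have ab: "a * b = t" and cd: "c * d = s / t" and ad: "a * d = 1" and bc: "b * c = s"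
    using A sq a st by (auto simp: c d) (auto simp: defs field_simps)
  have abcd: "a * b * c * d = s"
    using bc ad by (metis mult.assoc mult.commute mult_1)
  have pos: "0 < b" "0 < c" "0 < d" using A a sq st by (auto simp: defs c d u_def)
  have nb: "b < 1" and nd: "d < 1"
    using A a sq less_trans[OF sq(2) A] by (auto simp: defs(2) d divide_less_eq)
  \<comment> \<open>The ratio \<open>c / a = s / t\<close> lies strictly between \<open>q\<close>
    and 1, hence is not a power of \<open>q\<close>; this yields the separation condition of
    \<open>aw_Omega\<close>.\<close>
  have r: "q < s / t" "s / t < 1"
    using st s q by (auto simp: field_simps) (smt (verit) mult_left_le)
  have ac: "a \<noteq> q ^ l * c" "c \<noteq> q ^ l * a" for l
  proof -
    have ql: "q ^ l \<le> 1" "0 \<le> q ^ l" using q by (auto intro: power_le_one)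
    have "q ^ l * (s / t) \<le> 1 * (s / t)" using ql st by (intro mult_right_mono) auto
    then have "a * (q ^ l * (s / t)) < a * 1" using r a by (intro mult_strict_left_mono) auto
    then show "a \<noteq> q ^ l * c" by (simp add: c mult.left_commute)
    have "q ^ l \<noteq> s / t"
    proof (cases l)
      case (Suc n)
      have "q * q ^ n \<le> q * 1" using q by (intro mult_left_mono power_le_one) auto
      then show ?thesis using r Suc by auto
    qed (use r in auto)
    then show "c \<noteq> q ^ l * a" using a mult_left_cancel[of a "s / t" "q ^ l"] by (simp add: c mult.commute)
  qed
  have l: "complex_of_real q ^ l * (of_real a * of_real b * of_real c * of_real d) \<noteq> 1" for l
  proof -
    have "q ^ l * s \<le> 1 * s" using q st by (intro mult_right_mono power_le_one) auto
    then have "q ^ l * (a * b * c * d) \<noteq> 1" using st unfolding abcd by linarith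
    then show ?thesis by (metis of_real_mult of_real_power of_real_1 of_real_eq_iff)
  qed
  have ac': "complex_of_real a \<noteq> of_real q ^ l * of_real c" "complex_of_real c \<noteq> of_real q ^ l * of_real a" for l
    using ac[of l] by (metis of_real_mult of_real_power of_real_eq_iff)+
  have cond: "\<forall>i<4. \<forall>j<4. i \<noteq> j \<longrightarrow>
        norm ([complex_of_real a, of_real b, of_real c, of_real d] ! i) \<ge> 1 \<longrightarrow>
        norm ([complex_of_real a, of_real b, of_real c, of_real d] ! j) \<ge> 1 \<longrightarrow>
        (\<forall>l::nat. [complex_of_real a, of_real b, of_real c, of_real d] ! i \<noteq>
           of_real q ^ l * [complex_of_real a, of_real b, of_real c, of_real d] ! j)"
    using pos nb nd ac' by (auto simp: less_Suc_eq numeral_eq_Suc)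
  have Om: "(complex_of_real a, complex_of_real b, complex_of_real c, complex_of_real d) \<in> aw_Omega q"
    unfolding aw_Omega_def using ab cd st r l cond by auto
  have x: "complex_of_real (aw_point A s) = of_real ((u + 1 / u) / 2)"
    by (simp add: aw_point_def u_def)
  \<comment> \<open>For \<open>x = (u + 1 / u) / 2\<close> the number \<open>x\<^sup>2 - 1\<close>
    is the square of \<open>(u - 1 / u) / 2\<close>, which is positive, so \<open>csqrt\<close>
    returns this root.\<close>
  have "csqrt ((complex_of_real (aw_point A s))\<^sup>2 - 1) = csqrt ((complex_of_real ((u - 1 / u) / 2))\<^sup>2)"
    unfolding x using u by (intro arg_cong[where f = csqrt])
      (simp add: field_simps power2_eq_square)
  also have "\<dots> = of_real ((u - 1 / u) / 2)"
    using u by (intro csqrt_square) (auto simp: field_simps less_1_mult)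
  finally have root: "csqrt ((complex_of_real (aw_point A s))\<^sup>2 - 1) = of_real ((u - 1 / u) / 2)" .
  have r: "sqrt (s / t) * ((u + 1 / u) / 2 + (u - 1 / u) / 2) = c"
    "sqrt (s / t) * ((u + 1 / u) / 2 - (u - 1 / u) / 2) = d"
    by (simp_all add: defs field_simps)
  have c': "of_real (sqrt (s / t)) * (complex_of_real (aw_point A s) +
        csqrt ((complex_of_real (aw_point A s))\<^sup>2 - 1)) = of_real c"
    and d': "of_real (sqrt (s / t)) * (complex_of_real (aw_point A s) -
        csqrt ((complex_of_real (aw_point A s))\<^sup>2 - 1)) = of_real d"
    unfolding root unfolding x r[symmetric] by (simp_all only: of_real_mult of_real_add of_real_diff)
  have "aw_P q A (1 / A) s t (aw_point A s) g =
      aw_measure q (of_real a) (of_real b) (of_real c) (of_real d) g"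
    using False unfolding aw_P_def c' d' by (simp add: defs)
  also have "\<dots> = g (Re ((complex_of_real a + inverse (of_real a)) / 2))"
    using a nb nd pos ad by (intro aw_measure_degenerate q Om) (auto simp flip: of_real_mult)
  also have "Re ((complex_of_real a + inverse (of_real a)) / 2) = aw_point A t"
    by (simp add: aw_point_def defs field_simps flip: of_real_inverse of_real_add)
  finally show ?thesis .
qed

text \<open>Each transition carries the point mass along the curve \<open>aw_point A\<close>, so the
  iterated integral is an evaluation on that curve.\<close>

lemma aw_transitions_degenerate:
  fixes A s :: real
  assumes q: "0 \<le> q" "q < 1" and A: "1 < A"
  shows "sorted (s # ts) \<Longrightarrow> set (s # ts) \<subseteq> {max q (1 / A\<^sup>2)<..1} \<Longrightarrow>
    aw_transitions q A (1 / A) s (aw_point A s) ts G = G (map (aw_point A) ts)"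
proof (induction ts arbitrary: s G)
  case (Cons t ts)
  have "1 / A\<^sup>2 < s" using Cons.prems by simp
  then have "sqrt (1 / A\<^sup>2) < sqrt s" by simp
  then have "1 < A * sqrt s" using A by (simp add: real_sqrt_divide field_simps)
  then have "aw_transitions q A (1 / A) s (aw_point A s) (t # ts) G =
      aw_transitions q A (1 / A) t (aw_point A t) ts (\<lambda>ys. G (aw_point A t # ys))"
    using Cons.prems by (simp add: aw_P_degenerate[OF q A])
  also have "\<dots> = G (map (aw_point A) (t # ts))"
    using Cons.prems by (subst Cons.IH) auto
  finally show ?case .
qed simp

text \<open>The lower bound on the times collects three demands: \<open>q\<close> for the
  transitions, \<open>1 / A\<^sup>2\<close> for \<open>A * sqrt t > 1\<close>, and
  \<open>D\<^sup>2\<close> for the fourth parameter to have modulus below 1.\<close>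

lemma aw_joint_degenerate:
  fixes A D :: real
  assumes q: "0 \<le> q" "q < 1" and A: "1 < A" and D: "D \<le> 0"
    and ts: "sorted ts" "set ts \<subseteq> {max (max q (1 / A\<^sup>2)) (D\<^sup>2)<..1}"
  shows "aw_joint q A (1 / A) (1 / A) D ts G = G (map (aw_point A) ts)"
proof (cases ts)
  case (Cons t us)
  have t: "1 / A\<^sup>2 < t" "D\<^sup>2 < t" "t \<le> 1" "0 < t" using ts q Cons by auto
  then have "sqrt (1 / A\<^sup>2) < sqrt t" "sqrt (D\<^sup>2) < sqrt t"
    by (auto intro: real_sqrt_less_mono simp del: real_sqrt_abs)
  then have *: "1 < A * sqrt t" "\<bar>D\<bar> < sqrt t"
    using A unfolding real_sqrt_abs by (simp_all add: real_sqrt_divide field_simps)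
  have "aw_transitions q A (1 / A) t (aw_point A t) us (\<lambda>xs. G (aw_point A t # xs)) =
      G (map (aw_point A) (t # us))"
    using ts Cons by (subst aw_transitions_degenerate[OF q A]) auto
  then show ?thesis
    using t * by (simp add: Cons aw_pi_degenerate[OF q A D])
qed simp

section \<open>Moments and atoms\<close>

definition aw_atomic_part ::
  "real \<Rightarrow> complex \<Rightarrow> complex \<Rightarrow> complex \<Rightarrow> complex \<Rightarrow> (real \<Rightarrow> real) \<Rightarrow> real" where
  "aw_atomic_part q a b c d g =
     (\<Sum>k \<in> {k. 1 \<le> norm (a * of_real q ^ k)}. aw_mass q a b c d k * g (aw_atom q a k))"

lemma aw_measure_eq:
  assumes "(a, b, c, d) \<in> aw_Omega q"
  shows "aw_measure q a b c d g =
    aw_const q a b c d * (LBINT x:{-1<..<1}. aw_weight q a b c d x * g x) +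
    (aw_atomic_part q a b c d g + aw_atomic_part q b a c d g +
     aw_atomic_part q c b a d g + aw_atomic_part q d b c a g)"
  using assms by (simp add: aw_measure_def aw_atomic_part_def aw_density_eq mult.assoc)

lemma aw_atomic_part_lincomb:
  "aw_atomic_part q a b c d (\<lambda>x. y * f x + h x) = y * aw_atomic_part q a b c d f + aw_atomic_part q a b c d h"
  by (simp add: aw_atomic_part_def sum_distrib_left algebra_simps sum.distrib)

lemma aw_measure_lincomb:
  assumes q: "0 \<le> q" "q < 1"
    and generic: "\<And>e j. e \<in> {a, b, c, d} \<Longrightarrow> norm e * q ^ j \<noteq> 1"
    and f: "continuous_on UNIV f" and h: "continuous_on UNIV h"
  shows "aw_measure q a b c d (\<lambda>x. y * f x + h x) = y * aw_measure q a b c d f + aw_measure q a b c d h"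
proof (cases "(a, b, c, d) \<in> aw_Omega q")
  case True
  have "(LBINT x:{-1<..<1}. aw_weight q a b c d x * (y * f x + h x)) =
      (LBINT x:{-1<..<1}. y * (aw_weight q a b c d x * f x) + aw_weight q a b c d x * h x)"
    by (simp add: algebra_simps)
  also have "\<dots> = y * (LBINT x:{-1<..<1}. aw_weight q a b c d x * f x) +
      (LBINT x:{-1<..<1}. aw_weight q a b c d x * h x)"
    using set_integrable_aw_weight[OF q generic f] set_integrable_aw_weight[OF q generic h]
    by (simp add: set_integral_add set_integrable_mult_right)
  finally have *: "(LBINT x:{-1<..<1}. aw_weight q a b c d x * (y * f x + h x)) = \<dots>" .
  show ?thesis
    unfolding aw_measure_eq[OF True] aw_atomic_part_lincomb * by (simp add: ring_distribs)
qed (simp add: aw_measure_def)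

lemma aw_measure_zero: "aw_measure q a b c d (\<lambda>x. 0) = 0"
  by (simp add: aw_measure_def)

text \<open>Linearity in the coefficients of \<open>S\<close>. Only moments of order at least 1 are
  given, hence the factor \<open>w x ^ Suc n\<close>; each coefficient shifts the exponent by one,
  so \<open>n\<close> varies in the induction.\<close>

lemma aw_measure_poly:
  assumes q: "0 \<le> q" "q < 1"
    and generic: "\<And>e j. e \<in> {a, b, c, d} \<Longrightarrow> norm e * q ^ j \<noteq> 1"
    and w: "continuous_on UNIV w"
    and moments: "\<And>n. aw_measure q a b c d (\<lambda>x. w x ^ Suc n) = v ^ Suc n"
  shows "aw_measure q a b c d (\<lambda>x. w x ^ Suc n * poly S (w x)) = v ^ Suc n * poly S v"
proof (induction S arbitrary: n)
  case 0
  then show ?case by (simp add: aw_measure_zero)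
next
  case (pCons y S)
  have "aw_measure q a b c d (\<lambda>x. w x ^ Suc n * poly (pCons y S) (w x)) =
      aw_measure q a b c d (\<lambda>x. y * w x ^ Suc n + w x ^ Suc (Suc n) * poly S (w x))"
    by (simp add: algebra_simps)
  also have "\<dots> = y * v ^ Suc n + v ^ Suc (Suc n) * poly S v"
    using w by (subst aw_measure_lincomb[OF q generic])
      (auto intro!: continuous_intros simp: moments pCons.IH simp del: power_Suc)
  finally show ?case by (simp add: algebra_simps)
qed

text \<open>Testing with a product of squares that vanishes at \<open>v\<close> and at the value of
  \<open>w\<close> at each atom leaves only the constant times an integral. The integrand is
  positive on the interval off a finite set, so the constant must vanish.\<close>

lemma aw_const_eq_0I:
  fixes w :: "real \<Rightarrow> real"
  assumes q: "0 \<le> q" "q < 1"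
    and generic: "\<And>e j. e \<in> {a, b, c, d} \<Longrightarrow> norm e * q ^ j \<noteq> 1"
    and Om: "(a, b, c, d) \<in> aw_Omega q"
    and w: "continuous_on UNIV w" "inj w" "\<And>x. x \<in> {-1<..<1} \<Longrightarrow> 0 < w x"
    and polys: "\<And>S. aw_measure q a b c d (\<lambda>x. w x * poly S (w x)) = v * poly S v"
  shows "aw_const q a b c d = 0"
proof -
  let ?K = "\<lambda>e. {k. 1 \<le> norm (e * complex_of_real q ^ k)}"
  define Z where "Z = insert v (\<Union>e\<in>{a, b, c, d}. (\<lambda>k. w (aw_atom q e k)) ` ?K e)"
  define S where "S = (\<Prod>u\<in>Z. [:-u, 1:]\<^sup>2)"
  have Z: "finite Z" by (simp add: Z_def aw_atoms_finite[OF q])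
  have S: "poly S y = (\<Prod>u\<in>Z. (y - u)\<^sup>2)" for y
    by (simp add: S_def poly_prod)
  have S0: "poly S y = 0 \<longleftrightarrow> y \<in> Z" for y
    using Z by (auto simp: S)
  let ?g = "\<lambda>x. w x * poly S (w x)"
  have atoms: "aw_atomic_part q e a' b' c' ?g = 0" if "e \<in> {a, b, c, d}" for e a' b' c'
    unfolding aw_atomic_part_def using that S0 by (intro sum.neutral) (auto simp: Z_def)
  define G where "G x = indicator {-1<..<1} x * (aw_weight q a b c d x * ?g x)" for x
  have "v * poly S v = 0" using S0[of v] by (simp add: Z_def)
  then have "aw_const q a b c d * integral\<^sup>L lborel G = 0"
    using polys[of S] by (simp add: aw_measure_eq[OF Om] atoms set_lebesgue_integral_def G_def[abs_def])
  moreover have "integral\<^sup>L lborel G \<noteq> 0"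
  proof
    assume "integral\<^sup>L lborel G = 0"
    have pos: "0 < aw_weight q a b c d x" if "x \<in> {-1<..<1}" for x
      using aw_weight_pos[OF q generic that] .
    have "continuous_on UNIV ?g" using w(1) by (intro continuous_intros)
    from set_integrable_aw_weight[OF q generic this] have "integrable lborel G"
      by (simp add: set_integrable_def G_def[abs_def])
    moreover have "0 \<le> G x" for x
      using pos[of x] w(3)[of x] by (auto simp: G_def S indicator_def intro!: mult_nonneg_nonneg prod_nonneg)
    ultimately have "AE x in lborel. G x = 0"
      using \<open>integral\<^sup>L lborel G = 0\<close> by (simp add: integral_nonneg_eq_0_iff_AE)
    \<comment> \<open>Injectivity of \<open>w\<close> makes the zeros of \<open>poly S (w x)\<close>
      finite in number, hence a null set.\<close>
    moreover have "finite (w -` Z)"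
      using finite_vimageI[OF Z w(2)] .
    then have "AE x in lborel. x \<notin> w -` Z"
      by (intro AE_not_in finite_imp_null_set_lborel)
    ultimately have "AE x in lborel. x \<notin> {-1<..<1::real}"
    proof eventually_elim
      case (elim x)
      show ?case
      proof
        assume x: "x \<in> {-1<..<1}"
        then show False
          using elim pos[OF x] w(3)[OF x] S0[of "w x"] by (simp add: G_def)
      qed
    qed
    then have "emeasure lborel {-1<..<1::real} = 0"
      by (subst (asm) AE_iff_measurable[of "{-1<..<1}"]) auto
    then show False by simp
  qed
  ultimately show ?thesis by simp
qed

text \<open>A polynomial vanishing at \<open>v\<close> and at all other atoms isolates the mass of one atom.\<close>
lemma atom_eqI:
  fixes M Y :: "'i \<Rightarrow> real"
  assumes I: "finite I" "inj_on Y I"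
    and polys: "\<And>S. (\<Sum>i\<in>I. M i * (Y i * poly S (Y i))) = v * poly S v"
    and i: "i \<in> I" "M i \<noteq> 0" "Y i \<noteq> 0"
  shows "Y i = v"
proof (rule ccontr)
  assume ne: "Y i \<noteq> v"
  define S where "S = (\<Prod>u\<in>insert v (Y ` (I - {i})). [:-u, 1:])"
  have S: "poly S y = 0 \<longleftrightarrow> y \<in> insert v (Y ` (I - {i}))" for y
    using I by (simp add: S_def poly_prod)
  have "(\<Sum>j\<in>I. M j * (Y j * poly S (Y j))) = M i * (Y i * poly S (Y i))"
    using I(1) i(1) S by (subst sum.remove[of I i]) (auto intro!: sum.neutral)
  moreover have "poly S v = 0" by (simp add: S)
  moreover have "poly S (Y i) \<noteq> 0"
    using ne i(1) inj_onD[OF I(2)] by (auto simp: S)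
  ultimately show False using polys[of S] i by simp
qed

section \<open>At most one atom of nonzero mass\<close>

lemma joukowski_inj:
  fixes x y :: real
  assumes "1 \<le> x" "1 \<le> y" "x + 1 / x = y + 1 / y"
  shows "x = y"
proof (rule ccontr)
  assume ne: "x \<noteq> y"
  \<comment> \<open>Clearing denominators factors the equation; the second factor can vanish only at
    \<open>x = y = 1\<close> in the given range.\<close>
  have "(x - y) * (x * y - 1) = 0"
    using assms by (simp add: field_simps)
  then have "x * y = 1" using ne by simp
  then have "x * y \<le> 1 * y" "x * y \<le> x * 1" using assms by linarith+
  then have "x \<le> 1" "y \<le> 1" using assms by (auto simp: mult_le_cancel_right mult_le_cancel_left)
  then show False using assms ne by linarith
qed

lemma joukowski_ge:
  fixes x :: real
  assumes "1 \<le> x"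
  shows "2 \<le> x + 1 / x"
proof -
  have "0 \<le> (x - 1)\<^sup>2 / x" using assms by (intro divide_nonneg_nonneg) auto
  also have "\<dots> = x + 1 / x - 2" using assms by (simp add: power2_eq_square field_simps)
  finally show ?thesis by simp
qed

lemma aw_atom_real: "aw_atom q (of_real e) k = (e * q ^ k + 1 / (e * q ^ k)) / 2"
proof -
  have "(complex_of_real e * of_real q ^ k + inverse (of_real e * of_real q ^ k)) / 2 =
      of_real ((e * q ^ k + 1 / (e * q ^ k)) / 2)"
    by (simp add: inverse_eq_divide)
  then show ?thesis unfolding aw_atom_def by (simp only: Re_complex_of_real)
qed

lemma aw_Omega_ne:
  assumes "(a, b, c, d) \<in> aw_Omega q" "1 \<le> norm a" "1 \<le> norm c"
  shows "a \<noteq> of_real q ^ l * c" "c \<noteq> of_real q ^ l * a"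
proof -
  have *: "\<forall>i<4. \<forall>j<4. i \<noteq> j \<longrightarrow>
        norm ([a, b, c, d] ! i) \<ge> 1 \<longrightarrow> norm ([a, b, c, d] ! j) \<ge> 1 \<longrightarrow>
        (\<forall>l::nat. [a, b, c, d] ! i \<noteq> of_real q ^ l * [a, b, c, d] ! j)"
    using assms(1) by (simp add: aw_Omega_def)
  show "a \<noteq> of_real q ^ l * c" using *[rule_format, of 0 2 l] assms by simp
  show "c \<noteq> of_real q ^ l * a" using *[rule_format, of 2 0 l] assms by simp
qed

text \<open>Without density and with no atoms from \<open>b\<close> and \<open>d\<close>, the
  measure is a finite sum over the atoms of \<open>a\<close> and \<open>c\<close>. By
  \<open>atom_eqI\<close> every atom of nonzero mass has the same value \<open>v\<close> under the
  injective \<open>w\<close>, so two such atoms would coincide.\<close>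

lemma two_atoms_absurd:
  fixes a b c d :: real
  assumes q: "0 < q" "q < 1"
    and Om: "(complex_of_real a, complex_of_real b, complex_of_real c, complex_of_real d) \<in> aw_Omega q"
    and params: "1 < a" "\<bar>b\<bar> < 1" "0 < c" "\<bar>d\<bar> < 1"
    and const: "aw_const q a b c d = 0"
    and w: "inj w" "\<And>x. 1 \<le> x \<Longrightarrow> 0 < w x"
    and polys: "\<And>S. aw_measure q a b c d (\<lambda>x. w x * poly S (w x)) = v * poly S v"
    and mass_a: "aw_mass q a b c d 0 \<noteq> 0"
    and other: "1 \<le> a * q \<and> aw_mass q a b c d 1 \<noteq> 0 \<or> 1 \<le> c \<and> aw_mass q c b a d 0 \<noteq> 0"
  shows False
proof -
  let ?K = "\<lambda>e. {k. 1 \<le> norm (complex_of_real e * complex_of_real q ^ k)}"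
  have K: "k \<in> ?K e \<longleftrightarrow> 1 \<le> e * q ^ k" if "0 < e" for e k
    using that q by (simp add: norm_mult norm_power)
  have K1: "1 \<le> e" if "0 < e" "k \<in> ?K e" for e k
  proof -
    have "e * q ^ k \<le> e * 1" using that q by (intro mult_left_mono power_le_one) auto
    then show ?thesis using that(2) K[OF that(1), of k] by simp
  qed
  \<comment> \<open>Equality would make the quotient of \<open>a\<close> and \<open>c\<close> an
    integer power of \<open>q\<close>, against \<open>aw_Omega\<close>; the two cases are the two
    signs of the exponent.\<close>
  have sep: "a * q ^ k \<noteq> c * q ^ j" if "k \<in> ?K a" "j \<in> ?K c" for k j
  proof
    assume eq: "a * q ^ k = c * q ^ j"
    have c: "1 \<le> c" using K1 that(2) params by auto
    show False
    proof (cases "k \<le> j")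
      case True
      then have "q ^ k * a = q ^ k * (q ^ (j - k) * c)"
        using eq by (simp add: mult.commute mult.left_commute flip: power_add)
      then have "a = q ^ (j - k) * c" using q by simp
      then have "complex_of_real a = of_real q ^ (j - k) * of_real c"
        by (metis of_real_mult of_real_power)
      then show False using aw_Omega_ne(1)[OF Om] c params by auto
    next
      case False
      then have "q ^ j * c = q ^ j * (q ^ (k - j) * a)"
        using eq by (simp add: mult.commute mult.left_commute flip: power_add)
      then have "c = q ^ (k - j) * a" using q by simp
      then have "complex_of_real c = of_real q ^ (k - j) * of_real a"
        by (metis of_real_mult of_real_power)
      then show False using aw_Omega_ne(2)[OF Om] c params by auto
    qed
  qed
  have ac: "a \<noteq> c"
    using aw_Omega_ne(1)[OF Om, of 0] params by force
  define I where "I = Sigma {a, c} ?K"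
  define M where "M = (\<lambda>(e, k). if e = a then aw_mass q a b c d k else aw_mass q c b a d k)"
  define Y where "Y = (\<lambda>(e, k). w (aw_atom q (complex_of_real e) k))"
  have I: "finite I" using q by (simp add: I_def aw_atoms_finite)
  have pos: "0 < e" if "(e, k) \<in> I" for e k using that params by (auto simp: I_def)
  have inj_Y: "inj_on Y I"
  proof (rule inj_onI, clarify)
    fix e k e' k'
    assume i: "(e, k) \<in> I" "(e', k') \<in> I" and Y: "Y (e, k) = Y (e', k')"
    have ge: "1 \<le> e * q ^ k" "1 \<le> e' * q ^ k'"
      using i pos K by (auto simp: I_def)
    have "aw_atom q (complex_of_real e) k = aw_atom q (complex_of_real e') k'"
      using Y injD[OF w(1)] by (simp add: Y_def)
    then have "e * q ^ k + 1 / (e * q ^ k) = e' * q ^ k' + 1 / (e' * q ^ k')"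
      unfolding aw_atom_real by (metis divide_cancel_right zero_neq_numeral)
    from joukowski_inj[OF ge this] have eq: "e * q ^ k = e' * q ^ k'" .
    have e: "e = e'"
    proof (rule ccontr)
      assume "e \<noteq> e'"
      then have "e = a \<and> e' = c \<or> e = c \<and> e' = a" using i by (auto simp: I_def)
      then show False using sep eq i by (auto simp: I_def) metis+
    qed
    moreover have "k = k'"
      using eq q pos[OF i(1)] e by (simp add: power_inject_exp')
    ultimately show "e = e' \<and> k = k'" by simp
  qed
  have sums: "(\<Sum>i\<in>I. M i * (Y i * poly S (Y i))) = v * poly S v" for S
  proof -
    let ?g = "\<lambda>x. w x * poly S (w x)"
    have "aw_measure q a b c d ?g = aw_atomic_part q a b c d ?g + aw_atomic_part q c b a d ?g"
      using params q unfolding aw_measure_eq[OF Om] const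
      by (simp add: aw_atomic_part_def aw_atoms_empty)
    also have "\<dots> = (\<Sum>e\<in>{a, c}. \<Sum>k\<in>?K e. M (e, k) * (Y (e, k) * poly S (Y (e, k))))"
      using ac by (simp add: aw_atomic_part_def M_def Y_def)
    also have "\<dots> = (\<Sum>i\<in>I. M i * (Y i * poly S (Y i)))"
      using q unfolding I_def by (subst sum.Sigma) (auto simp: aw_atoms_finite split_def)
    finally show ?thesis using polys by simp
  qed
  \<comment> \<open>The test functions carry a factor \<open>w\<close>, which has to be cancelled at
    the atom; all atoms lie at 1 or above, where \<open>w\<close> is positive.\<close>
  have Y_ne: "Y i \<noteq> 0" if i: "i \<in> I" for i
  proof -
    obtain e k where ek: "i = (e, k)" by (cases i)
    have x: "1 \<le> e * q ^ k" using i ek pos K by (auto simp: I_def)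
    then have "2 \<le> e * q ^ k + 1 / (e * q ^ k)"
      by (rule joukowski_ge)
    then have "0 < w (aw_atom q (complex_of_real e) k)" by (intro w(2)) (simp add: aw_atom_real)
    then show ?thesis by (simp add: Y_def ek)
  qed
  have unique: "i = j" if "i \<in> I" "j \<in> I" "M i \<noteq> 0" "M j \<noteq> 0" for i j
  proof (rule inj_onD[OF inj_Y])
    show "Y i = Y j"
      using atom_eqI[OF I inj_Y sums that(1,3) Y_ne[OF that(1)]]
        atom_eqI[OF I inj_Y sums that(2,4) Y_ne[OF that(2)]] by simp
  qed (use that in auto)
  have "(a, 0) \<in> I" "M (a, 0) \<noteq> 0"
    using params mass_a by (auto simp: I_def M_def)
  moreover have "(a, 1) \<in> I \<and> M (a, 1) \<noteq> 0 \<or> (c, 0) \<in> I \<and> M (c, 0) \<noteq> 0"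
    using other params q ac by (auto simp: I_def M_def norm_mult)
  ultimately show False
    using unique[of "(a, 0)" "(a, 1)"] unique[of "(a, 0)" "(c, 0)"] ac by auto
qed

section \<open>Nonvanishing of masses at real parameters\<close>

lemma real_qpow_ne_1:
  fixes z :: real
  assumes "0 \<le> q" "q < 1" "z < 1"
  shows "z * q ^ j \<noteq> 1"
proof (cases "z \<le> 0")
  case True
  then have "z * q ^ j \<le> 0" using assms by (simp add: mult_nonpos_nonneg)
  then show ?thesis by linarith
next
  case False
  then have "z * q ^ j \<le> z * 1" using assms by (intro mult_left_mono power_le_one) auto
  then show ?thesis using assms by linarith
qed

lemma qpoch_inf_real:
  assumes "0 \<le> q" "q < 1"
  obtains r where "qpoch_inf q (map complex_of_real zs) = complex_of_real r"
    "r = 0 \<longleftrightarrow> (\<exists>z\<in>set zs. \<exists>j. z * q ^ j = 1)"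
proof -
  have "qpoch_inf q (map complex_of_real zs) \<in> \<real>"
    by (rule qpoch_inf_Reals[OF assms]) auto
  then obtain r where r: "qpoch_inf q (map complex_of_real zs) = complex_of_real r"
    by (auto elim: Reals_cases)
  have "complex_of_real z * of_real q ^ j = 1 \<longleftrightarrow> z * q ^ j = 1" for z j
    by (metis of_real_1 of_real_eq_iff of_real_mult of_real_power)
  then have "r = 0 \<longleftrightarrow> (\<exists>z\<in>set zs. \<exists>j. z * q ^ j = 1)"
    using qpoch_inf_eq_0_iff[OF assms, of "map complex_of_real zs"] r by simp
  with r show thesis by (rule that)
qed

text \<open>A symbol with real argument below 1 has no zero factor. The quotient
  \<open>c / a\<close> may be larger than 1 and gets a hypothesis of its own.\<close>

lemma aw_mass0_real:
  fixes a b c d :: real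
  assumes q: "0 \<le> q" "q < 1"
    and lt1: "inverse (a\<^sup>2) < 1" "b * c < 1" "b * d < 1" "c * d < 1" "b / a < 1" "d / a < 1" "a * b * c * d < 1"
    and ca: "\<And>j. c / a * q ^ j \<noteq> 1"
  obtains r where "aw_mass0 q a b c d = complex_of_real r" "r \<noteq> 0"
proof -
  obtain r1 where r1: "qpoch_inf q (map complex_of_real [inverse (a\<^sup>2), b * c, b * d, c * d]) = of_real r1"
      "r1 = 0 \<longleftrightarrow> (\<exists>z\<in>set [inverse (a\<^sup>2), b * c, b * d, c * d]. \<exists>j. z * q ^ j = 1)"
    by (rule qpoch_inf_real[OF q])
  obtain r2 where r2: "qpoch_inf q (map complex_of_real [b / a, c / a, d / a, a * b * c * d]) = of_real r2"
      "r2 = 0 \<longleftrightarrow> (\<exists>z\<in>set [b / a, c / a, d / a, a * b * c * d]. \<exists>j. z * q ^ j = 1)"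
    by (rule qpoch_inf_real[OF q])
  have "r1 \<noteq> 0" "r2 \<noteq> 0"
    using lt1 ca real_qpow_ne_1[OF q] unfolding r1(2) r2(2) list.set by blast+
  moreover have "aw_mass0 q a b c d = of_real (r1 / r2)"
    using r1(1) r2(1) by (simp add: aw_mass0_def)
  ultimately show thesis by (intro that[of "r1 / r2"]) auto
qed

text \<open>With all times equal the transitions are identities, so the multi-time integral involves
  a single variable and the product over sites becomes a power.\<close>

lemma bernoulli_moments:
  assumes L: "high_density_measure q A C D (product_bernoulli \<rho>)" and \<rho>: "0 \<le> \<rho>" "\<rho> \<le> 1"
  obtains \<epsilon> where "0 < \<epsilon>" "\<And>t n. 1 - \<epsilon> < t \<Longrightarrow> t \<le> 1 \<Longrightarrow>
    (1 - \<rho> + \<rho> * t) ^ Suc n =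
    (A / (1 + A)\<^sup>2) ^ Suc n * aw_pi q A (1 / A) C D t (\<lambda>x. (1 + t + 2 * sqrt t * x) ^ Suc n)"
proof -
  obtain \<epsilon> where \<epsilon>: "\<epsilon> > 0" and gen: "\<And>m ts. m \<ge> 1 \<Longrightarrow> length ts = m \<Longrightarrow> sorted ts \<Longrightarrow> set ts \<subseteq> {1 - \<epsilon><..1} \<Longrightarrow>
        (\<integral>\<tau>. (\<Prod>i<m. (ts ! i) ^ of_bool (\<tau> (Suc i))) \<partial>marginal m (product_bernoulli \<rho>)) =
        A ^ m / (1 + A) ^ (2 * m) *
        aw_joint q A (1 / A) C D ts
          (\<lambda>xs. \<Prod>i<m. (1 + ts ! i + 2 * sqrt (ts ! i) * xs ! i))"
    using L unfolding high_density_measure_def by blast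
  have trans: "aw_transitions q A (1 / A) t x (replicate n t) G = G (replicate n x)" for t x n G
    by (induction n arbitrary: G) (simp_all add: aw_P_def dirac_def)
  show thesis
  proof (rule that[OF \<epsilon>])
    fix t :: real and n :: nat
    assume t: "1 - \<epsilon> < t" "t \<le> 1"
    let ?m = "Suc n"
    have "(1 - \<rho> + \<rho> * t) ^ ?m = (\<Prod>i<?m. \<rho> * t ^ of_bool True + (1 - \<rho>) * t ^ of_bool False)"
      by (simp add: algebra_simps)
    also have "\<dots> = (\<integral>\<tau>. (\<Prod>i<?m. t ^ of_bool (\<tau> (Suc i))) \<partial>marginal ?m (product_bernoulli \<rho>))"
      unfolding integral_marginal[OF sets_product_bernoulli, where g = "\<lambda>_ b. t ^ of_bool b"]
      by (rule integral_product_bernoulli[OF \<rho>, symmetric])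
    also have "\<dots> = (\<integral>\<tau>. (\<Prod>i<?m. (replicate ?m t ! i) ^ of_bool (\<tau> (Suc i))) \<partial>marginal ?m (product_bernoulli \<rho>))"
      by (intro Bochner_Integration.integral_cong prod.cong refl) (simp del: replicate_Suc)
    also have "\<dots> = A ^ ?m / (1 + A) ^ (2 * ?m) *
        aw_joint q A (1 / A) C D (replicate ?m t)
          (\<lambda>xs. \<Prod>i<?m. (1 + replicate ?m t ! i + 2 * sqrt (replicate ?m t ! i) * xs ! i))"
      using t by (intro gen) auto
    also have "A ^ ?m / (1 + A) ^ (2 * ?m) = (A / (1 + A)\<^sup>2) ^ ?m"
      by (simp only: power_divide power_mult)
    also have "aw_joint q A (1 / A) C D (replicate ?m t)
          (\<lambda>xs. \<Prod>i<?m. (1 + replicate ?m t ! i + 2 * sqrt (replicate ?m t ! i) * xs ! i)) =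
        aw_pi q A (1 / A) C D t (\<lambda>x. \<Prod>i<?m. (1 + replicate ?m t ! i +
          2 * sqrt (replicate ?m t ! i) * replicate ?m x ! i))"
      by (simp add: trans del: prod.lessThan_Suc nth_Cons_Suc)
    also have "(\<lambda>x. \<Prod>i<?m. (1 + replicate ?m t ! i + 2 * sqrt (replicate ?m t ! i) * replicate ?m x ! i)) =
        (\<lambda>x. (1 + t + 2 * sqrt t * x) ^ ?m)"
    proof
      fix x
      have "(\<Prod>i<?m. (1 + replicate ?m t ! i + 2 * sqrt (replicate ?m t ! i) * replicate ?m x ! i)) =
          (\<Prod>i<?m. 1 + t + 2 * sqrt t * x)"
        by (intro prod.cong refl) (simp del: replicate_Suc)
      then show "(\<Prod>i<?m. (1 + replicate ?m t ! i + 2 * sqrt (replicate ?m t ! i) * replicate ?m x ! i)) =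
          (1 + t + 2 * sqrt t * x) ^ ?m" by simp
    qed
    finally show "(1 - \<rho> + \<rho> * t) ^ ?m =
      (A / (1 + A)\<^sup>2) ^ ?m * aw_pi q A (1 / A) C D t (\<lambda>x. (1 + t + 2 * sqrt t * x) ^ ?m)" .
  qed
qed

section \<open>Product measures\<close>

text \<open>For such \<open>t\<close> no parameter of \<open>\<pi>\<^sub>t\<close> makes the density singular at \<open>x = \<plusminus>1\<close>.\<close>
lemma generic_time:
  fixes A C l :: real
  assumes "l < 1" "0 \<le> l"
  obtains t where "l < t" "t < 1" "\<And>j. A * sqrt t * q ^ j \<noteq> 1" "\<And>j. C / sqrt t * q ^ j \<noteq> 1"
proof -
  \<comment> \<open>Countably many times are bad, and an open interval is uncountable. If
    \<open>A * q ^ j = 0\<close>, the equation to be avoided cannot hold, so the value given to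
    division by zero does no harm.\<close>
  define bad where "bad = range (\<lambda>j. (1 / (A * q ^ j))\<^sup>2) \<union> range (\<lambda>j::nat. (C * q ^ j)\<^sup>2)"
  have "uncountable ({l<..<1} - bad)"
    using assms by (intro uncountable_minus_countable) (auto simp: bad_def uncountable_open_interval)
  then obtain t where t: "l < t" "t < 1" "t \<notin> bad"
    using uncountable_def by (metis DiffE countable_empty equals0I greaterThanLessThan_iff)
  have st: "0 < sqrt t" "t = (sqrt t)\<^sup>2" using t assms by auto
  have "A * sqrt t * q ^ j \<noteq> 1" for j
  proof
    assume *: "A * sqrt t * q ^ j = 1"
    then have "A * q ^ j \<noteq> 0" by (metis mult_eq_0_iff zero_neq_one)
    moreover have "sqrt t * (A * q ^ j) = 1" using * by (simp only: mult_ac)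
    ultimately have "sqrt t = 1 / (A * q ^ j)"
      using nonzero_eq_divide_eq[of "A * q ^ j" "sqrt t" 1] by blast
    then show False using t(3) st(2) by (auto simp: bad_def)
  qed
  moreover have "C / sqrt t * q ^ j \<noteq> 1" for j
  proof
    assume "C / sqrt t * q ^ j = 1"
    then have "sqrt t = C * q ^ j" using st(1) by (simp add: field_simps)
    then show False using t(3) st(2) by (auto simp: bad_def)
  qed
  ultimately show thesis using t that by blast
qed

section \<open>A Bernoulli law forces AC = 1\<close>

lemma bernoulli_imp_AC_eq_1:
  fixes q A C D \<rho> :: real
  assumes q: "0 \<le> q" "q < 1" and A: "1 < A" and C: "0 \<le> C" "C < A" and D: "-1 < D" "D \<le> 0"
    and CA: "C \<ge> 1 \<Longrightarrow> C / A \<notin> {q ^ l | l::nat. l \<ge> 1}"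
    and L: "high_density_measure q A C D (product_bernoulli \<rho>)" and \<rho>: "0 \<le> \<rho>" "\<rho> \<le> 1"
  shows "A * C = 1"
proof -
  obtain \<epsilon> where \<epsilon>: "0 < \<epsilon>" and mom: "\<And>t n. 1 - \<epsilon> < t \<Longrightarrow> t \<le> 1 \<Longrightarrow>
      (1 - \<rho> + \<rho> * t) ^ Suc n =
      (A / (1 + A)\<^sup>2) ^ Suc n * aw_pi q A (1 / A) C D t (\<lambda>x. (1 + t + 2 * sqrt t * x) ^ Suc n)"
    using bernoulli_moments[OF L \<rho>] by blast
  \<comment> \<open>Lower bounds for \<open>t\<close>, in order: positivity, validity of the moment
    formula, \<open>a > 1\<close>, \<open>|d| < 1\<close>, \<open>c / a < 1\<close>, and
    \<open>a * q > 1\<close> in the case \<open>A * q > 1\<close>.\<close>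
  define T where "T = {0, 1 - \<epsilon>, 1 / A\<^sup>2, D\<^sup>2, C / A, if 1 < A * q then 1 / (A * q)\<^sup>2 else 0}"
  define l where "l = Max T"
  have T: "finite T" "T \<noteq> {}" by (simp_all add: T_def)
  have le_l: "x \<le> l" if "x \<in> T" for x
    unfolding l_def using T(1) that by (rule Max_ge)
  have "1 < A * q \<Longrightarrow> 1 / (A * q)\<^sup>2 < 1"
    using one_less_power[of "A * q" 2] by (smt (verit) divide_less_eq_1_pos zero_less_numeral)
  then have "l < 1"
    using \<epsilon> A C D one_less_power[of A 2]
    unfolding l_def Max_less_iff[OF T] by (auto simp: T_def abs_square_less_1)
  moreover have "0 \<le> l" by (rule le_l) (simp add: T_def)
  ultimately obtain t where t: "l < t" "t < 1"
    and gen_A: "\<And>j. A * sqrt t * q ^ j \<noteq> 1" and gen_C: "\<And>j. C / sqrt t * q ^ j \<noteq> 1"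
    using generic_time[of l A q C] by blast
  have T_less: "x < t" if "x \<in> T" for x using le_l[OF that] t(1) by linarith
  have tl: "0 < t" "1 - \<epsilon> < t" "1 / A\<^sup>2 < t" "D\<^sup>2 < t" "C / A < t"
    "1 < A * q \<Longrightarrow> 1 / (A * q)\<^sup>2 < t"
    by (rule T_less, simp add: T_def)+
  have st: "0 < sqrt t" "sqrt t < 1" "sqrt t * sqrt t = t" using t tl by auto
  define a b c d where "a = A * sqrt t" "b = 1 / A * sqrt t" "c = C / sqrt t" "d = D / sqrt t"
  note defs = this
  have sqrt_lt: "sqrt x < sqrt t" if "x < t" for x using that by simp
  have a: "1 < a"
    using sqrt_lt[OF tl(3)] A by (simp add: defs real_sqrt_divide field_simps)
  have b: "0 < b" "b < 1"
    using A st less_trans[OF st(2) A] by (auto simp: defs divide_less_eq)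
  have c: "0 \<le> c" using C st by (simp add: defs)
  have d: "\<bar>d\<bar> < 1" "d \<le> 0"
    using sqrt_lt[OF tl(4)] D st unfolding defs by (simp_all add: abs_divide less_divide_eq divide_nonpos_pos)
  have prods: "a * b = t" "a * c = A * C" "a * d = A * D" "b * c = C / A" "b * d = D / A" "c * d = C * D / t"
    using A st by (auto simp: defs field_simps)
  have abcd: "a * b * c * d = C * D"
    using prods st tl by (simp add: mult.assoc)
  have CD: "C * D \<le> 0" "A * D \<le> 0" "D / A \<le> 0" "C * D / t \<le> 0"
    using A C D tl by (auto simp: mult_nonneg_nonpos divide_nonpos_pos)
  define w where "w x = 1 + t + 2 * sqrt t * x" for x
  define \<kappa> where "\<kappa> = A / (1 + A)\<^sup>2"
  \<comment> \<open>The value at which \<open>w\<close> is concentrated as far as its moments can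
    tell: the one-site generating function divided by the prefactor.\<close>
  define v where "v = (1 - \<rho> + \<rho> * t) / \<kappa>"
  have \<kappa>: "0 < \<kappa>" using A by (simp add: \<kappa>_def)
  have "0 < 1 - \<rho> + \<rho> * t"
  proof (cases "\<rho> = 0")
    case False
    then have "0 < \<rho> * t" using \<rho> tl by simp
    then show ?thesis using \<rho> by linarith
  qed simp
  then have v: "0 < v" using \<kappa> by (simp add: v_def)
  have moments: "aw_measure q a b c d (\<lambda>x. w x ^ Suc n) = v ^ Suc n" for n
  proof -
    have "aw_measure q a b c d (\<lambda>x. w x ^ Suc n) = aw_pi q A (1 / A) C D t (\<lambda>x. (1 + t + 2 * sqrt t * x) ^ Suc n)"
      using t by (simp add: aw_pi_def defs w_def)
    moreover have "(\<kappa> * v) ^ Suc n = \<kappa> ^ Suc n * aw_pi q A (1 / A) C D t (\<lambda>x. (1 + t + 2 * sqrt t * x) ^ Suc n)"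
      using mom[of t n] t tl \<kappa> by (simp add: \<kappa>_def v_def del: power_Suc)
    ultimately show ?thesis using \<kappa> by (simp add: power_mult_distrib del: power_Suc)
  qed
  \<comment> \<open>outside \<open>\<Omega>\<close> the functional is 0, contradicting \<open>v > 0\<close>\<close>
  have Om: "(complex_of_real a, complex_of_real b, complex_of_real c, complex_of_real d) \<in> aw_Omega q"
    using moments[of 0] v by (auto simp: aw_measure_def split: if_splits)
  have generic: "norm e * q ^ j \<noteq> 1"
    if "e \<in> {complex_of_real a, complex_of_real b, complex_of_real c, complex_of_real d}" for e j
  proof -
    have "\<bar>b\<bar> * q ^ j \<noteq> 1" "\<bar>d\<bar> * q ^ j \<noteq> 1"
      using b d by (intro real_qpow_ne_1[OF q], simp)+
    moreover have "\<bar>a\<bar> * q ^ j \<noteq> 1" "\<bar>c\<bar> * q ^ j \<noteq> 1"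
      using gen_A[of j] gen_C[of j] a c by (simp_all add: defs(1,3)[symmetric])
    ultimately show ?thesis using that by (auto simp only: norm_of_real insert_iff empty_iff)
  qed
  have cont: "continuous_on UNIV w" unfolding w_def by (intro continuous_intros)
  have inj: "inj w" using st by (auto simp: inj_def w_def)
  \<comment> \<open>\<open>w\<close> is increasing and equals the square of
    \<open>1 - sqrt t\<close> at -1.\<close>
  have w_pos: "0 < w x" if "-1 < x" for x
  proof -
    have "0 \<le> (1 - sqrt t)\<^sup>2" by simp
    also have "\<dots> = 1 + t + 2 * sqrt t * (-1)"
      using st by (simp add: power2_eq_square algebra_simps)
    also have "\<dots> < w x" unfolding w_def using that st by (intro add_strict_left_mono mult_strict_left_mono) auto
    finally show ?thesis .
  qed
  have polys: "aw_measure q a b c d (\<lambda>x. w x * poly S (w x)) = v * poly S v" for S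
    using aw_measure_poly[OF q generic cont moments, of 0 S] by simp
  have const: "aw_const q a b c d = 0"
    by (rule aw_const_eq_0I[OF q generic Om cont inj _ polys]) (use w_pos in auto)
  obtain r1 where r1: "qpoch_inf q (map complex_of_real [q, a * b, a * c, a * d, b * c, b * d, c * d]) = of_real r1"
      "r1 = 0 \<longleftrightarrow> (\<exists>z\<in>set [q, a * b, a * c, a * d, b * c, b * d, c * d]. \<exists>j. z * q ^ j = 1)"
    by (rule qpoch_inf_real[OF q])
  obtain r2 where r2: "qpoch_inf q (map complex_of_real [a * b * c * d]) = of_real r2"
      "r2 = 0 \<longleftrightarrow> (\<exists>z\<in>set [a * b * c * d]. \<exists>j. z * q ^ j = 1)"
    by (rule qpoch_inf_real[OF q])
  have "r2 \<noteq> 0"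
    using real_qpow_ne_1[OF q, of "C * D"] CD unfolding r2(2) list.set abcd by auto
  moreover have "r1 / r2 = 0"
    using const r1(1) r2(1) by (simp add: aw_const_def)
  ultimately have "r1 = 0" by simp
  \<comment> \<open>All other numerator arguments of the constant are below 1, so the zero must come
    from the symbol of \<open>a * c = A * C\<close>.\<close>
  moreover have "z * q ^ j \<noteq> 1" if "z \<in> {q, t, A * D, C / A, D / A, C * D / t}" for z j
    using that q t A C D CD by (intro real_qpow_ne_1[OF q]) auto
  ultimately obtain n where n: "A * C * q ^ n = 1"
    unfolding r1(2) list.set prods by blast
  show ?thesis
  proof (cases n)
    case 0
    then show ?thesis using n by simp
  next
    case (Suc m)
    have q0: "0 < q" using n Suc q by (cases "q = 0") auto
    have Cpos: "0 < C" using n C by (cases "C = 0") auto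
    have AC: "1 \<le> A * C * q"
    proof -
      have "A * C * q * q ^ m \<le> A * C * q * 1"
        using A Cpos q by (intro mult_left_mono power_le_one) auto
      then show ?thesis using n Suc by (simp add: mult.assoc)
    qed
    have AC_ne: "a * c \<noteq> 1"
    proof
      assume "a * c = 1"
      then have "A * C * q < 1" using prods q by simp
      then show False using AC by simp
    qed
    have base: "a * b < 1" "b * c < 1" "b * d < 1" "c * d < 1" "a * d < 1" "a * b * c * d < 1"
    proof -
      show "a * b < 1" using prods t by simp
      show "b * c < 1" using C A by (simp add: prods)
      show "b * d < 1" "c * d < 1" "a * d < 1" using prods CD by linarith+
      show "a * b * c * d < 1" using abcd CD by linarith
    qed
    have lt1: "inverse (a\<^sup>2) < 1" "b * c < 1" "b * d < 1" "c * d < 1" "b / a < 1" "d / a < 1" "a * b * c * d < 1"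
      using base a b d by (auto simp: divide_less_eq one_less_power inverse_less_1_iff)
    \<comment> \<open>The choice \<open>t > C / A\<close> puts \<open>c / a\<close> below 1, so the
      symbol of \<open>c / a\<close> in the mass of the first atom of \<open>a\<close> is
      nonzero.\<close>
    have "c / a = C / A / t" using A st by (simp add: defs field_simps)
    then have "c / a < 1" using tl(1,5) divide_less_eq_1_pos[of t "C / A"] by simp
    then obtain r where r: "aw_mass0 q a b c d = complex_of_real r" "r \<noteq> 0"
      using aw_mass0_real[OF q lt1] real_qpow_ne_1[OF q, of "c / a"] by blast
    have mass_a: "aw_mass q a b c d 0 \<noteq> 0" using r by (simp add: aw_mass_def)
    \<comment> \<open>If \<open>A * q > 1\<close>, the second atom comes from \<open>a\<close> with
      index 1. Otherwise \<open>A * C * q \<ge> 1\<close> forces \<open>C \<ge> 1\<close>, and the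
      first atom of \<open>c\<close> serves.\<close>
    have other: "1 \<le> a * q \<and> aw_mass q a b c d 1 \<noteq> 0 \<or> 1 \<le> c \<and> aw_mass q c b a d 0 \<noteq> 0"
    proof (cases "1 < A * q")
      case True
      have aq: "1 < a * q"
        using sqrt_lt[OF tl(6)[OF True]] True A q0 by (simp add: defs real_sqrt_divide real_sqrt_mult field_simps)
      \<comment> \<open>Equality would give \<open>c > 1\<close>, hence two entries of modulus at
        least 1 with ratio \<open>q\<close>, which \<open>aw_Omega\<close> forbids.\<close>
      have "c \<noteq> q * a"
      proof
        assume *: "c = q * a"
        then have "1 \<le> c" using aq by (simp add: mult.commute)
        then have "complex_of_real c \<noteq> of_real q ^ 1 * of_real a"
          using a by (intro aw_Omega_ne(2)[OF Om]) auto
        then show False using * by simp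
      qed
      moreover have "a\<^sup>2 \<noteq> 1" "a\<^sup>2 * q\<^sup>2 \<noteq> 1"
        using one_less_power[OF a, of 2] one_less_power[OF aq, of 2] by (auto simp: power_mult_distrib)
      moreover have "b \<noteq> q * a" "d \<noteq> q * a" using b d aq by (auto simp: mult.commute)
      moreover have "a * b \<noteq> 1" "a * d \<noteq> 1" using prods t CD by auto
      \<comment> \<open>\<open>?R\<close> is the mass formula at \<open>k = 1\<close>, where each
        finite symbol is a single factor. Division by zero would return 0, so the denominator has to
        be nonzero as well.\<close>
      ultimately have "r * q * (1 - a\<^sup>2 * q\<^sup>2) * ((1 - a\<^sup>2) * (1 - a * b) * (1 - a * c) * (1 - a * d)) /
          ((1 - q) * (1 - a\<^sup>2) * a * ((b - q * a) * (c - q * a) * (d - q * a))) \<noteq> 0" (is "?R \<noteq> 0")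
        using r q0 q a AC_ne by auto
      moreover have "aw_mass q a b c d 1 = ?R"
      proof -
        have a2: "a\<^sup>2 \<noteq> 1" "(complex_of_real a)\<^sup>2 \<noteq> 1"
          using \<open>a\<^sup>2 \<noteq> 1\<close> by (auto simp flip: of_real_power)
        have "complex_of_real r * of_real q ^ 1 * (1 - (of_real a)\<^sup>2 * of_real q ^ (2 * 1)) *
            qpoch q [(of_real a)\<^sup>2, of_real a * of_real b, of_real a * of_real c, of_real a * of_real d] 1 /
            (qpoch q [of_real q] 1 * (1 - (of_real a)\<^sup>2) * of_real a ^ 1 *
              (\<Prod>l = 1..1. (of_real b - of_real q ^ l * of_real a) * (of_real c - of_real q ^ l * of_real a) *
                (of_real d - of_real q ^ l * of_real a))) = complex_of_real ?R"
          using a2 by (simp add: qpoch_def)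
        then have "aw_mass q a b c d 1 = Re (complex_of_real ?R)"
          unfolding aw_mass_def Let_def r(1) by (simp only: one_neq_zero if_False)
        then show ?thesis by simp
      qed
      ultimately show ?thesis using aq by simp
    next
      case False
      have "1 \<le> C"
      proof -
        have "A * q * C \<le> 1 * C" using False Cpos by (intro mult_right_mono) auto
        then show ?thesis using AC by (simp add: mult_ac)
      qed
      \<comment> \<open>\<open>C = 1\<close> would force \<open>A * q = 1\<close>, that is
        \<open>C / A = q\<close>, which the hypothesis on \<open>C / A\<close> excludes.\<close>
      moreover have "C \<noteq> 1"
      proof
        assume "C = 1"
        then have "C / A = q ^ 1" using AC False A by (simp add: field_simps)
        then have "C / A \<in> {q ^ l | l::nat. l \<ge> 1}" by blast
        then show False using CA \<open>C = 1\<close> by (metis order_refl)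
      qed
      ultimately have "1 < C" by simp
      also have "C \<le> c" using Cpos st by (simp add: defs field_simps)
      finally have c1: "1 < c" .
      have lt1': "inverse (c\<^sup>2) < 1" "b * a < 1" "b * d < 1" "a * d < 1" "b / c < 1" "d / c < 1" "c * b * a * d < 1"
        using base c1 b d by (auto simp: divide_less_eq one_less_power inverse_less_1_iff mult_ac)
      \<comment> \<open>With the roles of \<open>a\<close> and \<open>c\<close> exchanged the
        critical quotient may exceed 1, and \<open>aw_Omega\<close> takes the place of a
        bound.\<close>
      have ac: "a / c * q ^ j \<noteq> 1" for j
      proof
        assume "a / c * q ^ j = 1"
        then have "c = q ^ j * a" using c1 by (simp add: field_simps)
        moreover have "complex_of_real c \<noteq> of_real q ^ j * of_real a"
          using a c1 by (intro aw_Omega_ne(2)[OF Om]) auto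
        ultimately show False by (metis of_real_mult of_real_power)
      qed
      obtain r' where "aw_mass0 q c b a d = complex_of_real r'" "r' \<noteq> 0"
        using aw_mass0_real[OF q lt1' ac] by blast
      then show ?thesis using c1 by (simp add: aw_mass_def)
    qed
    have "0 < c" using Cpos st by (simp add: defs)
    then show ?thesis
      using two_atoms_absurd[OF q0 q(2) Om a _ _ d(1) const inj _ polys mass_a other] b w_pos by auto
  qed
qed

section \<open>AC = 1 forces the Bernoulli law\<close>

lemma eq_product_bernoulli_if_AC_eq_1:
  fixes q A D :: real
  assumes q: "0 \<le> q" "q < 1" and A: "1 < A" and D: "-1 < D" "D \<le> 0"
    and L: "high_density_measure q A (1 / A) D L"
  shows "L = product_bernoulli (A / (1 + A))"
proof -
  have prob: "prob_space L" and sets: "sets L = sets (configs {1..})"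
    using L by (auto simp: high_density_measure_def)
  obtain \<epsilon> where \<epsilon>: "\<epsilon> > 0" and gen: "\<And>m ts. m \<ge> 1 \<Longrightarrow> length ts = m \<Longrightarrow> sorted ts \<Longrightarrow> set ts \<subseteq> {1 - \<epsilon><..1} \<Longrightarrow>
        (\<integral>\<tau>. (\<Prod>i<m. (ts ! i) ^ of_bool (\<tau> (Suc i))) \<partial>marginal m L) =
        A ^ m / (1 + A) ^ (2 * m) *
        aw_joint q A (1 / A) (1 / A) D ts
          (\<lambda>xs. \<Prod>i<m. (1 + ts ! i + 2 * sqrt (ts ! i) * xs ! i))"
    using L unfolding high_density_measure_def by blast
  define \<rho> where "\<rho> = A / (1 + A)"
  have \<rho>: "0 \<le> \<rho>" "\<rho> \<le> 1" using A by (auto simp: \<rho>_def)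
  define l where "l = max (max q (1 / A\<^sup>2)) (D\<^sup>2)"
  have l: "l < 1" "0 \<le> l" using q A D by (auto simp: l_def abs_square_less_1)
  \<comment> \<open>Times above \<open>1 - \<delta>\<close> satisfy both the generating function
    formula and the bound under which all measures are point masses.\<close>
  define \<delta> where "\<delta> = min \<epsilon> (1 - l)"
  have \<delta>: "0 < \<delta>" using \<epsilon> l by (simp add: \<delta>_def)
  \<comment> \<open>At the point mass the bracket times \<open>A\<close> equals
    \<open>(1 + A) * (1 + A * t)\<close>; division by the square of \<open>1 + A\<close> leaves the
    generating function of one Bernoulli variable with density \<open>A / (1 + A)\<close>.\<close>
  have site: "A / (1 + A)\<^sup>2 * (1 + t + 2 * sqrt t * aw_point A t) = \<rho> * t + (1 - \<rho>)" if "0 < t" for t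
  proof -
    have "2 * sqrt t * aw_point A t = A * t + 1 / A"
      using that A by (simp add: aw_point_def field_simps)
    then have "A * (1 + t + 2 * sqrt t * aw_point A t) = (1 + A) * (1 + A * t)"
      using A by (simp add: algebra_simps)
    then have "A / (1 + A)\<^sup>2 * (1 + t + 2 * sqrt t * aw_point A t) = (1 + A) * (1 + A * t) / (1 + A)\<^sup>2"
      by simp
    also have "\<dots> = (1 + A * t) / (1 + A)"
      using A by (simp add: power2_eq_square)
    also have "\<dots> = \<rho> * t + (1 - \<rho>)"
      using A by (simp add: \<rho>_def field_simps)
    finally show ?thesis .
  qed
  have "(\<integral>\<tau>. (\<Prod>i<m. g i (\<tau> (Suc i))) \<partial>L) = (\<Prod>i<m. \<rho> * g i True + (1 - \<rho>) * g i False)"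
    for m and g :: "nat \<Rightarrow> bool \<Rightarrow> real"
  proof (rule multilinear_eq_of_sorted[where \<epsilon> = \<delta> and m = m and g = g and
        \<Phi> = "\<lambda>g. \<integral>\<tau>. (\<Prod>i<m. g i (\<tau> (Suc i))) \<partial>L" and
        \<Psi> = "\<lambda>g. \<Prod>i<m. \<rho> * g i True + (1 - \<rho>) * g i False", OF \<delta>])
    note int = integrable_cylinder_prod[OF prob _ sets]
    fix g :: "nat \<Rightarrow> bool \<Rightarrow> real" and k x y f h
    assume k: "k < m"
    \<comment> \<open>Pulling out the factor of index \<open>k\<close> exposes the linear dependence
      on the function at \<open>k\<close>; the generality of \<open>F\<close> covers both sides of
      the identity.\<close>
    have split: "(\<Prod>i<m. F i ((g(k := e)) i)) = F k e * (\<Prod>i\<in>{..<m} - {k}. F i (g i))"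
      for F :: "nat \<Rightarrow> (bool \<Rightarrow> real) \<Rightarrow> real" and e
      using k by (subst prod.remove[of _ k]) auto
    show "(\<Prod>i<m. \<rho> * (g(k := \<lambda>b. x * f b + y * h b)) i True + (1 - \<rho>) * (g(k := \<lambda>b. x * f b + y * h b)) i False) =
        x * (\<Prod>i<m. \<rho> * (g(k := f)) i True + (1 - \<rho>) * (g(k := f)) i False) +
        y * (\<Prod>i<m. \<rho> * (g(k := h)) i True + (1 - \<rho>) * (g(k := h)) i False)"
      unfolding split[of "\<lambda>i e. \<rho> * e True + (1 - \<rho>) * e False"] by (simp add: algebra_simps)
    have "(\<integral>\<tau>. (\<Prod>i<m. (g(k := \<lambda>b. x * f b + y * h b)) i (\<tau> (Suc i))) \<partial>L) =
        (\<integral>\<tau>. x * (\<Prod>i<m. (g(k := f)) i (\<tau> (Suc i))) + y * (\<Prod>i<m. (g(k := h)) i (\<tau> (Suc i))) \<partial>L)"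
      unfolding split[of "\<lambda>i e. e (_ (Suc i))"]
      by (intro Bochner_Integration.integral_cong refl) (simp add: algebra_simps)
    also have "\<dots> = x * (\<integral>\<tau>. (\<Prod>i<m. (g(k := f)) i (\<tau> (Suc i))) \<partial>L) +
        y * (\<integral>\<tau>. (\<Prod>i<m. (g(k := h)) i (\<tau> (Suc i))) \<partial>L)"
      using int[of m "g(k := f)"] int[of m "g(k := h)"] by (subst Bochner_Integration.integral_add) auto
    finally show "(\<integral>\<tau>. (\<Prod>i<m. (g(k := \<lambda>b. x * f b + y * h b)) i (\<tau> (Suc i))) \<partial>L) = \<dots>" .
  next
    fix g :: "nat \<Rightarrow> bool \<Rightarrow> real" and t :: "nat \<Rightarrow> real"
    assume g: "\<And>i. i < m \<Longrightarrow> g i = (\<lambda>b. t i ^ of_bool b)"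
      and t: "\<And>i. i < m \<Longrightarrow> 1 - \<delta> < t i \<and> t i \<le> 1" and mono: "mono_on {..<m} t"
    show "(\<integral>\<tau>. (\<Prod>i<m. g i (\<tau> (Suc i))) \<partial>L) = (\<Prod>i<m. \<rho> * g i True + (1 - \<rho>) * g i False)"
    \<comment> \<open>The generating function is prescribed for \<open>m \<ge> 1\<close> only; for
      the empty product both sides are 1.\<close>
    proof (cases "m = 0")
      case True
      interpret prob_space L by (rule prob)
      show ?thesis using True by (simp add: prob_space)
    next
      case False
      define ts where "ts = map t [0..<m]"
      have ts: "length ts = m" "sorted ts" "set ts \<subseteq> {1 - \<delta><..1}" "\<And>i. i < m \<Longrightarrow> ts ! i = t i"
        using t mono by (auto simp: ts_def sorted_iff_nth_mono mono_on_def)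
      have sub: "set ts \<subseteq> {1 - \<epsilon><..1}" "set ts \<subseteq> {l<..1}"
        using ts(3) by (force simp: \<delta>_def)+
      have "(\<integral>\<tau>. (\<Prod>i<m. g i (\<tau> (Suc i))) \<partial>L) = (\<integral>\<tau>. (\<Prod>i<m. (ts ! i) ^ of_bool (\<tau> (Suc i))) \<partial>marginal m L)"
        unfolding integral_marginal[OF sets, where g = "\<lambda>i b. ts ! i ^ of_bool b"]
        by (intro Bochner_Integration.integral_cong prod.cong refl) (simp add: g ts)
      also have "\<dots> = A ^ m / (1 + A) ^ (2 * m) * aw_joint q A (1 / A) (1 / A) D ts
          (\<lambda>xs. \<Prod>i<m. (1 + ts ! i + 2 * sqrt (ts ! i) * xs ! i))"
        using False ts sub by (intro gen) auto
      also have "A ^ m / (1 + A) ^ (2 * m) = (A / (1 + A)\<^sup>2) ^ m"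
        by (simp only: power_divide power_mult)
      also have "aw_joint q A (1 / A) (1 / A) D ts (\<lambda>xs. \<Prod>i<m. (1 + ts ! i + 2 * sqrt (ts ! i) * xs ! i)) =
          (\<Prod>i<m. (1 + ts ! i + 2 * sqrt (ts ! i) * map (aw_point A) ts ! i))"
        using ts(2) sub(2) unfolding l_def by (intro aw_joint_degenerate q A D)
      also have "\<dots> = (\<Prod>i<m. 1 + t i + 2 * sqrt (t i) * aw_point A (t i))"
        using ts by (intro prod.cong) auto
      also have "(A / (1 + A)\<^sup>2) ^ m * \<dots> = (\<Prod>i<m. A / (1 + A)\<^sup>2 * (1 + t i + 2 * sqrt (t i) * aw_point A (t i)))"
        unfolding prod.distrib prod_constant card_lessThan ..
      also have "\<dots> = (\<Prod>i<m. \<rho> * g i True + (1 - \<rho>) * g i False)"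
      proof (intro prod.cong refl)
        fix i assume "i \<in> {..<m}"
        then have i: "i < m" by simp
        then have "0 < t i" using t[of i] l by (auto simp: \<delta>_def)
        from site[OF this] show "A / (1 + A)\<^sup>2 * (1 + t i + 2 * sqrt (t i) * aw_point A (t i)) =
            \<rho> * g i True + (1 - \<rho>) * g i False" by (simp add: g[OF i])
      qed
      finally show ?thesis .
    qed
  qed
  then have "L = product_bernoulli \<rho>"
    by (intro measure_eqI_cylinder_prod prob sets prob_space_product_bernoulli sets_product_bernoulli)
      (simp add: integral_product_bernoulli[OF \<rho>])
  then show ?thesis by (simp add: \<rho>_def)
qed

section \<open>The equivalence and the value of the density\<close>

theorem proposition1p8:
  fixes q A B C D :: real and L :: "(nat \<Rightarrow> bool) measure"
  assumes "0 \<le> q" "q < 1"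
    and "open_asep_parameters q A B C D"
    and "0 \<le> A" "0 \<le> C" "-1 < B" "B \<le> 0" "-1 < D" "D \<le> 0"
    and "A > 1" "A > C"
    and "C \<ge> 1 \<Longrightarrow> C / A \<notin> {q ^ l | l::nat. l \<ge> 1}"
    and "high_density_measure q A C D L"
  shows "((\<exists>\<rho>\<in>{0..1}. L = product_bernoulli \<rho>) \<longleftrightarrow> A * C = 1) \<and>
    (A * C = 1 \<longrightarrow> L = product_bernoulli (A / (1 + A)))"
proof -
  have bernoulli: "L = product_bernoulli (A / (1 + A))" if "A * C = 1"
  proof -
    have "C = 1 / A" using that \<open>A > 1\<close> by (simp add: field_simps)
    then show ?thesis using eq_product_bernoulli_if_AC_eq_1[of q A D L] assms by simp
  qed
  moreover have "A / (1 + A) \<in> {0..1}" using \<open>A > 1\<close> by simp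
  moreover have "A * C = 1" if "\<rho> \<in> {0..1}" "L = product_bernoulli \<rho>" for \<rho>
    by (rule bernoulli_imp_AC_eq_1[of q A C D \<rho>]) (use assms that in auto)
  ultimately show ?thesis by blast
qed

end
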